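(* Let $\Phi$ be a TD system on $V$ of $q$-Racah type with diameter $d\ge1$ and associated nonzero scalars $q,a,b\in\mathbb{K}$. View $V$ as the $U_q(\mathfrak{sl}_2)$-module in which $e,f,k,k^{-1}$ act as $(q-q^{-1})^{-1}\psi$, $(q-q^{-1})^{-1}R$, $K$, $K^{-1}$ respectively. Then for every integer $i$ with $0\le i\le d/2$, $MK_i$ is an eigenspace for (the action on $V$ of) the normalized Casimir element $\Lambda$, with corresponding eigenvalue $q^{d-2i+1}+q^{2i-d-1}$.
   Context: Let $\mathbb{K}$ be an algebraically closed field, $V$ a nonzero finite-dimensional $\mathbb{K}$-vector space, $\mathrm{End}(V)$ the algebra of linear maps $V\to V$, and $I$ the identity. For $X\in\mathrm{End}(V)$, a subspace $W\subseteq V$ is an eigenspace of $X$ whenever $W\neq0$ and there exists $\theta\in\mathbb{K}$ such that $W=\{v\in V\mid Xv=\theta v\}$; in this case $\theta$ is the eigenvalue of $X$ associated with $W$. The map $X$ is diagonalizable whenever $V$ is spanned by the eigenspaces of $X$. TD pairs and systems. A tridiagonal (TD) pair on $V$ is an ordered pair $A,A^*\in\mathrm{End}(V)$ such that: (i) each of $A,A^*$ is diagonalizable; (ii) there is an ordering $\{V_i\}_{i=0}^d$ of the eigenspaces of $A$ with $A^*V_i\subseteq V_{i-1}+V_i+V_{i+1}$ for $0\le i\le d$ ($V_{-1}=V_{d+1}=0$); (iii) there is an ordering $\{V_i^*\}_{i=0}^\delta$ of the eigenspaces of $A^*$ with $AV_i^*\subseteq V_{i-1}^*+V_i^*+V_{i+1}^*$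 for $0\le i\le \delta$ ($V^*_{-1}=V^*_{\delta+1}=0$); (iv) there is no subspace $W$ with $AW\subseteq W$, $A^*W\subseteq W$, $W\ne0$, $W\neq V$. It is known that $d=\delta$ (the diameter); assume $d\ge1$. Orderings as in (ii), (iii) are called standard. The primitive idempotent for an eigenspace of a diagonalizable map is the projection onto it along the sum of the other eigenspaces; an ordering of the primitive idempotents is standard if the corresponding ordering of eigenspaces is. A TD system on $V$ is a sequence $\Phi=(A;\{E_i\}_{i=0}^d;A^*;\{E_i^*\}_{i=0}^d)$ where $A,A^*$ is a TD pair on $V$ and $\{E_i\}$ (resp. $\{E_i^*\}$) is a standard ordering of the primitive idempotents of $A$ (resp. $A^*$). Let $\theta_i$ (resp. $\theta_i^*$) be the eigenvalue of $A$ (resp. $A^*$) for $E_i$ (resp. $E_i^*$). $\Phi$ has $q$-Racah type, with scalars $q,a,b$, if $q,a,b\in\mathbb{K}$ are nonzero, $q^4\ne1$, and $\theta_i=aq^{d-2i}+a^{-1}q^{2i-d}$, $\theta_i^*=bq^{d-2i}+b^{-1}q^{2i-d}$ for $0\le i\le d$. Split decomposition. For $0\le i\le d$ let $U_i=(E_0^*V+\cdots+E_i^*V)\cap(E_iV+\cdots+E_dV)$. It is known that $V=\bigoplus_{i=0}^dU_i$. For $0\le i\le d/2$ let $K_i=(E_0^*V+\cdots+E_i^*V)\cap(E_iV+\cdots+E_{d-i}V)$. Let $M$ be the (unital) subalgebra of $\mathrm{End}(V)$ generated by $A$; $MK_i$ is the $M$-submodule of $V$ generated by $K_i$. The maps.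 $K\in\mathrm{End}(V)$ acts on $U_i$ as $q^{d-2i}I$ for $0\le i\le d$; it is invertible. Put $R=A-aK-a^{-1}K^{-1}$. The map $\psi$ is the element of $\mathrm{End}(V)$, known to exist and be unique, such that $\psi R-R\psi=(q-q^{-1})(K-K^{-1})$ and $\psi K_i=0$ for $0\le i\le d/2$. $U_q(\mathfrak{sl}_2)$ is the unital associative $\mathbb{K}$-algebra with generators $e,f,k,k^{-1}$ and relations $kk^{-1}=k^{-1}k=1$, $kek^{-1}=q^2e$, $kfk^{-1}=q^{-2}f$, $ef-fe=\frac{k-k^{-1}}{q-q^{-1}}$. Its normalized Casimir element is $\Lambda=(q-q^{-1})^2ef+q^{-1}k+qk^{-1}=(q-q^{-1})^2fe+qk+q^{-1}k^{-1}$. The assignment in the claim does define a $U_q(\mathfrak{sl}_2)$-module structure on $V$.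
   Formalization: MK_i can be 0 (e.g. for Leonard systems with i ≥ 1), and 0 is not an eigenspace by definition; the theorem proves MK_i = {v : Λv = (q^{d-2i+1}+q^{2i-d-1})v} for all i, and that MK_i is an eigenspace whenever MK_i ≠ 0. *)

theory Defs
  imports
    "HOL-Computational_Algebra.Polynomial"
    "HOL-Algebra.QuotRing"
    "HOL-Library.Poly_Mapping"
begin

section \<open>Eigenspaces, TD systems and the split decomposition\<close>

text \<open>
  The vector space \<open>V\<close> is the whole type \<open>'b\<close> with scalar multiplication \<open>scale\<close>;
  elements of \<open>End(V)\<close> are functions \<open>X\<close> with \<open>Vector_Spaces.linear scale scale X\<close>.
  Sequences indexed by \<open>0..d\<close> are functions on \<open>nat\<close> of which only the values
  at \<open>0..d\<close> matter.
\<close>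

text \<open>
  A copy of \<open>vector_space\<close>, which is already interpreted for real vector spaces;
  definitions made in it directly would be shadowed by their real instances.
\<close>

locale lin_space = vector_space scale
  for scale :: "'a::field \<Rightarrow> 'b::ab_group_add \<Rightarrow> 'b"
begin

abbreviation endo :: "('b \<Rightarrow> 'b) \<Rightarrow> bool" where
  "endo X \<equiv> Vector_Spaces.linear scale scale X"

definition eigenspace_with_eigenvalue :: "('b \<Rightarrow> 'b) \<Rightarrow> 'b set \<Rightarrow> 'a \<Rightarrow> bool" where
  "eigenspace_with_eigenvalue X W \<theta> \<longleftrightarrow>
     subspace W \<and> W \<noteq> {0} \<and> W = {v. X v = scale \<theta> v}"

definition is_eigenspace :: "('b \<Rightarrow> 'b) \<Rightarrow> 'b set \<Rightarrow> bool" where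
  "is_eigenspace X W \<longleftrightarrow> (\<exists>\<theta>. eigenspace_with_eigenvalue X W \<theta>)"

definition diagonalizable :: "('b \<Rightarrow> 'b) \<Rightarrow> bool" where
  "diagonalizable X \<longleftrightarrow> span (\<Union>{W. is_eigenspace X W}) = UNIV"

definition sum_spaces :: "(nat \<Rightarrow> 'b set) \<Rightarrow> nat set \<Rightarrow> 'b set" where
  "sum_spaces W J = span (\<Union>j\<in>J. W j)"

text \<open>
  The intersection with \<open>{..d}\<close> and truncated subtraction on \<open>nat\<close> implement the
  convention that the spaces with index \<open>-1\<close> and \<open>d + 1\<close> are zero.
\<close>

definition standard_ordering :: "('b \<Rightarrow> 'b) \<Rightarrow> ('b \<Rightarrow> 'b) \<Rightarrow> nat \<Rightarrow> (nat \<Rightarrow> 'b set) \<Rightarrow> bool" where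
  "standard_ordering A B d W \<longleftrightarrow>
     bij_betw W {..d} {U. is_eigenspace A U} \<and>
     (\<forall>i\<le>d. B ` W i \<subseteq> sum_spaces W ({i - 1..i + 1} \<inter> {..d}))"

definition TD_pair :: "('b \<Rightarrow> 'b) \<Rightarrow> ('b \<Rightarrow> 'b) \<Rightarrow> bool" where
  "TD_pair A As \<longleftrightarrow>
     endo A \<and> endo As \<and> diagonalizable A \<and> diagonalizable As \<and>
     (\<exists>d W. standard_ordering A As d W) \<and>
     (\<exists>\<delta> Ws. standard_ordering As A \<delta> Ws) \<and>
     \<not> (\<exists>W. subspace W \<and> A ` W \<subseteq> W \<and> As ` W \<subseteq> W \<and> W \<noteq> {0} \<and> W \<noteq> UNIV)"

definition primitive_idempotent :: "('b \<Rightarrow> 'b) \<Rightarrow> 'b set \<Rightarrow> ('b \<Rightarrow> 'b) \<Rightarrow> bool" where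
  "primitive_idempotent X W P \<longleftrightarrow>
     is_eigenspace X W \<and> endo P \<and> (\<forall>v\<in>W. P v = v) \<and>
     (\<forall>v\<in>span (\<Union>{U. is_eigenspace X U \<and> U \<noteq> W}). P v = 0)"

definition standard_idempotents :: "('b \<Rightarrow> 'b) \<Rightarrow> ('b \<Rightarrow> 'b) \<Rightarrow> nat \<Rightarrow> (nat \<Rightarrow> 'b \<Rightarrow> 'b) \<Rightarrow> bool" where
  "standard_idempotents A B d E \<longleftrightarrow>
     (\<exists>W. standard_ordering A B d W \<and> (\<forall>i\<le>d. primitive_idempotent A (W i) (E i)))"

definition TD_system ::
  "nat \<Rightarrow> ('b \<Rightarrow> 'b) \<Rightarrow> (nat \<Rightarrow> 'b \<Rightarrow> 'b) \<Rightarrow> ('b \<Rightarrow> 'b) \<Rightarrow> (nat \<Rightarrow> 'b \<Rightarrow> 'b) \<Rightarrow> bool" where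
  "TD_system d A E As Es \<longleftrightarrow>
     TD_pair A As \<and> standard_idempotents A As d E \<and> standard_idempotents As A d Es"

definition q_Racah ::
  "nat \<Rightarrow> ('b \<Rightarrow> 'b) \<Rightarrow> (nat \<Rightarrow> 'b \<Rightarrow> 'b) \<Rightarrow> ('b \<Rightarrow> 'b) \<Rightarrow> (nat \<Rightarrow> 'b \<Rightarrow> 'b) \<Rightarrow>
   'a \<Rightarrow> 'a \<Rightarrow> 'a \<Rightarrow> bool" where
  "q_Racah d A E As Es q a b \<longleftrightarrow>
     q \<noteq> 0 \<and> a \<noteq> 0 \<and> b \<noteq> 0 \<and> q ^ 4 \<noteq> 1 \<and>
     (\<forall>i\<le>d.
        eigenspace_with_eigenvalue A (range (E i))
          (a * q powi (int d - 2 * int i) + inverse a * q powi (2 * int i - int d)) \<and>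
        eigenspace_with_eigenvalue As (range (Es i))
          (b * q powi (int d - 2 * int i) + inverse b * q powi (2 * int i - int d)))"

definition split_U :: "nat \<Rightarrow> (nat \<Rightarrow> 'b \<Rightarrow> 'b) \<Rightarrow> (nat \<Rightarrow> 'b \<Rightarrow> 'b) \<Rightarrow> nat \<Rightarrow> 'b set" where
  "split_U d E Es i =
     sum_spaces (\<lambda>j. range (Es j)) {0..i} \<inter> sum_spaces (\<lambda>j. range (E j)) {i..d}"

text \<open>Only used for \<open>2 * i \<le> d\<close>, where the subtraction does not truncate.\<close>

definition split_K :: "nat \<Rightarrow> (nat \<Rightarrow> 'b \<Rightarrow> 'b) \<Rightarrow> (nat \<Rightarrow> 'b \<Rightarrow> 'b) \<Rightarrow> nat \<Rightarrow> 'b set" where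
  "split_K d E Es i =
     sum_spaces (\<lambda>j. range (Es j)) {0..i} \<inter> sum_spaces (\<lambda>j. range (E j)) {i..d - i}"

definition subalgebra_End :: "('b \<Rightarrow> 'b) set \<Rightarrow> bool" where
  "subalgebra_End S \<longleftrightarrow>
     S \<subseteq> {X. endo X} \<and> id \<in> S \<and>
     (\<forall>X\<in>S. \<forall>Y\<in>S. (\<lambda>v. X v + Y v) \<in> S \<and> X \<circ> Y \<in> S) \<and>
     (\<forall>c. \<forall>X\<in>S. (\<lambda>v. scale c (X v)) \<in> S)"

definition generated_subalgebra :: "('b \<Rightarrow> 'b) \<Rightarrow> ('b \<Rightarrow> 'b) set" where
  "generated_subalgebra A = subalgebra_End hull {A}"

definition generated_submodule :: "('b \<Rightarrow> 'b) set \<Rightarrow> 'b set \<Rightarrow> 'b set" where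
  "generated_submodule M S = (\<lambda>W. subspace W \<and> (\<forall>X\<in>M. X ` W \<subseteq> W)) hull S"

definition MK :: "nat \<Rightarrow> ('b \<Rightarrow> 'b) \<Rightarrow> (nat \<Rightarrow> 'b \<Rightarrow> 'b) \<Rightarrow> (nat \<Rightarrow> 'b \<Rightarrow> 'b) \<Rightarrow> nat \<Rightarrow> 'b set" where
  "MK d A E Es i = generated_submodule (generated_subalgebra A) (split_K d E Es i)"

definition End_ring :: "('b \<Rightarrow> 'b) ring" where
  "End_ring = \<lparr>carrier = {X. endo X}, mult = (\<circ>), one = id,
     zero = (\<lambda>v. 0), add = (\<lambda>X Y v. X v + Y v)\<rparr>"

end


section \<open>The algebra $U_q(\mathfrak{sl}_2)$\<close>

datatype uq_gen = Gen_e | Gen_f | Gen_k | Gen_kinv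

text \<open>
  Words under concatenation, written additively, so that \<open>uq_word \<Rightarrow>\<^sub>0 'a\<close> with the
  convolution product of \<open>HOL-Library.Poly_Mapping\<close> is the free unital associative
  algebra on the four generators.
\<close>

datatype uq_word = Word (letters: "uq_gen list")

instantiation uq_word :: monoid_add
begin

definition zero_uq_word :: uq_word where
  "0 = Word []"

definition plus_uq_word :: "uq_word \<Rightarrow> uq_word \<Rightarrow> uq_word" where
  "u + v = Word (letters u @ letters v)"

instance
  by standard (simp_all add: zero_uq_word_def plus_uq_word_def)

end

type_synonym 'a uq_free = "uq_word \<Rightarrow>\<^sub>0 'a"

definition uq_scalar :: "'a::field \<Rightarrow> 'a uq_free" where
  "uq_scalar c = Poly_Mapping.single 0 c"

definition uq_gen :: "uq_gen \<Rightarrow> 'a::field uq_free" where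
  "uq_gen g = Poly_Mapping.single (Word [g]) 1"

definition uq_free_ring :: "'a::field uq_free ring" where
  "uq_free_ring = \<lparr>carrier = UNIV, mult = (*), one = 1, zero = 0, add = (+)\<rparr>"

definition uq_relators :: "'a::field \<Rightarrow> 'a uq_free set" where
  "uq_relators q =
     (let e = uq_gen Gen_e; f = uq_gen Gen_f; k = uq_gen Gen_k; k' = uq_gen Gen_kinv
      in {k * k' - 1, k' * k - 1,
          k * e * k' - uq_scalar (q ^ 2) * e,
          k * f * k' - uq_scalar (inverse (q ^ 2)) * f,
          e * f - f * e - uq_scalar (inverse (q - inverse q)) * (k - k')})"

definition uq_ideal :: "'a::field \<Rightarrow> 'a uq_free set" where
  "uq_ideal q = Idl\<^bsub>uq_free_ring\<^esub> (uq_relators q)"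

definition Uq_sl2 :: "'a::field \<Rightarrow> 'a uq_free set ring" where
  "Uq_sl2 q = uq_free_ring Quot uq_ideal q"

definition uq_class :: "'a::field \<Rightarrow> 'a uq_free \<Rightarrow> 'a uq_free set" where
  "uq_class q x = uq_ideal q +>\<^bsub>uq_free_ring\<^esub> x"

definition casimir :: "'a::field \<Rightarrow> 'a uq_free set" where
  "casimir q =
     uq_class q (uq_scalar ((q - inverse q) ^ 2) * uq_gen Gen_e * uq_gen Gen_f
       + uq_scalar (inverse q) * uq_gen Gen_k + uq_scalar q * uq_gen Gen_kinv)"

text \<open>
  A \<open>U_q(sl_2)\<close>-module structure on \<open>V\<close>: a homomorphism of unital \<open>\<bbbK>\<close>-algebras
  from \<open>U_q(sl_2)\<close> to \<open>End(V)\<close>, that is, a ring homomorphism compatible with scalars.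
\<close>

definition (in lin_space) Uq_module :: "'a \<Rightarrow> ('a uq_free set \<Rightarrow> 'b \<Rightarrow> 'b) \<Rightarrow> bool" where
  "Uq_module q \<rho> \<longleftrightarrow>
     \<rho> \<in> ring_hom (Uq_sl2 q) End_ring \<and>
     (\<forall>c. \<rho> (uq_class q (uq_scalar c)) = scale c)"


lemma uq_ring: "ring uq_free_ring"
proof -
  have "\<exists>y. y + x = 0" for x :: "'a uq_free" by (rule exI[of _ "- x"]) simp
  moreover have "\<exists>y. x + y = 0 \<and> y + x = 0" for x :: "'a uq_free" by (rule exI[of _ "- x"]) simp
  ultimately show ?thesis
  unfolding uq_free_ring_def
  by unfold_locales (auto simp: algebra_simps Units_def)
qed

lemma ideal_uq_ideal: "ideal (uq_ideal q) uq_free_ring"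
  unfolding uq_ideal_def by (rule ring.genideal_ideal[OF uq_ring]) (simp add: uq_free_ring_def)

lemma uq_class_hom: "uq_class q \<in> ring_hom uq_free_ring (Uq_sl2 q)"
proof -
  have "uq_class q = (+>\<^bsub>uq_free_ring\<^esub>) (uq_ideal q)" by (auto simp: uq_class_def)
  then show ?thesis using ideal.rcos_ring_hom[OF ideal_uq_ideal[of q]] by (simp add: Uq_sl2_def)
qed

lemma uq_class_eq: "uq_class q x = uq_class q y \<longleftrightarrow> x - y \<in> uq_ideal q"
proof -
  interpret ideal "uq_ideal q" uq_free_ring by (rule ideal_uq_ideal)
  have m: "a_minus uq_free_ring x y = x - y"
  proof -
    have "a_inv uq_free_ring y = - y"
      by (rule minus_equality) (auto simp: uq_free_ring_def)
    then show ?thesis by (simp add: a_minus_def) (simp add: uq_free_ring_def)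
  qed
  have c: "x \<in> carrier uq_free_ring" "y \<in> carrier uq_free_ring" by (auto simp: uq_free_ring_def)
  have "uq_class q x = uq_class q y \<longleftrightarrow> a_minus uq_free_ring x y \<in> uq_ideal q"
    using quotient_eq_iff_same_a_r_cos[OF ideal_uq_ideal c] by (auto simp: uq_class_def)
  then show ?thesis by (simp add: m)
qed

lemma uq_relators_subset: "uq_relators q \<subseteq> uq_ideal q"
  unfolding uq_ideal_def by (rule ring.genideal_self[OF uq_ring]) (simp add: uq_free_ring_def)

lemma uq_ideal_closed: "x \<in> uq_ideal q \<Longrightarrow> y * x \<in> uq_ideal q"  "x \<in> uq_ideal q \<Longrightarrow> x * y \<in> uq_ideal q"
  "x \<in> uq_ideal q \<Longrightarrow> z \<in> uq_ideal q \<Longrightarrow> x + z \<in> uq_ideal q"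
proof -
  interpret ideal "uq_ideal q" uq_free_ring by (rule ideal_uq_ideal)
  show "x \<in> uq_ideal q \<Longrightarrow> y * x \<in> uq_ideal q"  "x \<in> uq_ideal q \<Longrightarrow> x * y \<in> uq_ideal q"
    using I_l_closed[of x y] I_r_closed[of x y] by (auto simp: uq_free_ring_def)
  show "x \<in> uq_ideal q \<Longrightarrow> z \<in> uq_ideal q \<Longrightarrow> x + z \<in> uq_ideal q"
    using additive_subgroup.a_closed[OF additive_subgroup_axioms, of x z] by (simp add: uq_free_ring_def)
qed

lemma uq_scalar_mult: "uq_scalar a * uq_scalar b = uq_scalar (a*b)"
  by (simp add: uq_scalar_def mult_single)

lemma uq_scalar_add: "uq_scalar a + uq_scalar b = uq_scalar (a+b)"
  by (simp add: uq_scalar_def single_add)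

lemma uq_scalar_diff: "uq_scalar a - uq_scalar b = uq_scalar (a-b)"
  by (simp add: uq_scalar_def single_diff)

text \<open>The two expressions for the normalized Casimir element agree.\<close>

lemma casimir_eq_fe:
  assumes "q \<noteq> 0" "q - inverse q \<noteq> 0"
  shows "casimir q =
     uq_class q (uq_scalar ((q - inverse q) ^ 2) * uq_gen Gen_f * uq_gen Gen_e
       + uq_scalar q * uq_gen Gen_k + uq_scalar (inverse q) * uq_gen Gen_kinv)"
  unfolding casimir_def uq_class_eq
proof -
  let ?c = "(q - inverse q)"
  let ?r = "uq_gen Gen_e * uq_gen Gen_f - uq_gen Gen_f * uq_gen Gen_e 
    - uq_scalar (inverse ?c) * (uq_gen Gen_k - uq_gen Gen_kinv)"
  have "?r \<in> uq_ideal q" using uq_relators_subset[of q] by (simp add: uq_relators_def Let_def)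
  then have r: "uq_scalar (?c^2) * ?r \<in> uq_ideal q" by (rule uq_ideal_closed)
  have s: "uq_scalar (?c^2) * uq_scalar (inverse ?c) = uq_scalar q - uq_scalar (inverse q)"
  proof -
    have "?c^2 * inverse ?c = ?c" using assms(2) by (metis power2_eq_square mult.assoc right_inverse mult_1_right)
    then show ?thesis by (simp only: uq_scalar_mult uq_scalar_diff)
  qed
  have "uq_scalar (?c^2) * ?r = uq_scalar (?c^2) * (uq_gen Gen_e * uq_gen Gen_f - uq_gen Gen_f * uq_gen Gen_e) 
     - (uq_scalar (?c^2) * uq_scalar (inverse ?c)) * (uq_gen Gen_k - uq_gen Gen_kinv)"
    by (simp only: right_diff_distrib mult.assoc)
  also have "\<dots> = uq_scalar (?c ^ 2) * uq_gen Gen_e * uq_gen Gen_f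
       + uq_scalar (inverse q) * uq_gen Gen_k + uq_scalar q * uq_gen Gen_kinv
      - (uq_scalar (?c ^ 2) * uq_gen Gen_f * uq_gen Gen_e
       + uq_scalar q * uq_gen Gen_k + uq_scalar (inverse q) * uq_gen Gen_kinv)"
    unfolding s by (simp add: algebra_simps)
  finally show "uq_scalar (?c ^ 2) * uq_gen Gen_e * uq_gen Gen_f
       + uq_scalar (inverse q) * uq_gen Gen_k + uq_scalar q * uq_gen Gen_kinv
      - (uq_scalar (?c ^ 2) * uq_gen Gen_f * uq_gen Gen_e
       + uq_scalar q * uq_gen Gen_k + uq_scalar (inverse q) * uq_gen Gen_kinv) \<in> uq_ideal q" using r by simp
qed

context lin_space begin

definition word_action :: "(uq_gen \<Rightarrow> 'b \<Rightarrow> 'b) \<Rightarrow> uq_word \<Rightarrow> 'b \<Rightarrow> 'b" where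
 "word_action G w v = foldr G (letters w) v"

definition free_action :: "(uq_gen \<Rightarrow> 'b \<Rightarrow> 'b) \<Rightarrow> 'a uq_free \<Rightarrow> 'b \<Rightarrow> 'b" where
 "free_action G x v = (\<Sum>w\<in>Poly_Mapping.keys x. scale (Poly_Mapping.lookup x w) (word_action G w v))"

lemma word_action_add: "word_action G (u + w) v = word_action G u (word_action G w v)"
  by (simp add: word_action_def plus_uq_word_def)

lemma free_action_add: "free_action G (x + y) v = free_action G x v + free_action G y v"
  unfolding free_action_def by (rule setsum_keys_plus_distrib) (auto simp: scale_left_distrib)

lemma free_action_single: "free_action G (Poly_Mapping.single w c) v = scale c (word_action G w v)"
  by (simp add: free_action_def)

lemma free_action_0: "free_action G 0 v = 0" by (simp add: free_action_def)

lemma uq_free_induct: assumes "P 0" "\<And>x w c. P x \<Longrightarrow> P (x + Poly_Mapping.single w (c::'a))" shows "P (x::'a uq_free)"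
proof (induction x rule: update_induct)
  case const show ?case by (rule assms)
next
  case (update f a b)
  have "Poly_Mapping.update a b f = f + Poly_Mapping.single a b"
    using update by (intro poly_mapping_eqI) (auto simp: lookup_update lookup_add lookup_single when_def in_keys_iff)
  then show ?case using assms(2) update by simp
qed

lemma word_action_lin: assumes "\<And>g. endo (G g)" shows "endo (word_action G w)"
proof -
  have "endo (\<lambda>v. foldr G l v)" for l
  proof (induction l)
    case Nil then show ?case by (simp add: linear_id[unfolded id_def])
  next
    case (Cons g l)
    have "endo (G g \<circ> foldr G l)" by (rule Vector_Spaces.linear_compose[OF Cons assms])
    then show ?case by (simp add: o_def)
  qed
  then show ?thesis by (simp add: word_action_def[abs_def])
qed

lemma free_action_lin: assumes "\<And>g. endo (G g)" shows "endo (free_action G x)"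
proof -
  interpret W: Vector_Spaces.linear scale scale "word_action G w" for w by (rule word_action_lin[OF assms])
  show ?thesis
    by unfold_locales (auto simp: free_action_def W.add W.scale scale_right_distrib sum.distrib scale_sum_right mult.commute)
qed

lemma free_action_single_mult:
  assumes "\<And>g. endo (G g)"
  shows "free_action G (Poly_Mapping.single w c * y) v = scale c (word_action G w (free_action G y v))"
proof (induction y rule: uq_free_induct)
  case 1
  interpret W: Vector_Spaces.linear scale scale "word_action G w" by (rule word_action_lin[OF assms])
  show ?case by (simp add: free_action_0 W.zero)
next
  case (2 y u a)
  interpret W: Vector_Spaces.linear scale scale "word_action G w" by (rule word_action_lin[OF assms])
  show ?case
    using 2 by (simp add: distrib_left free_action_add mult_single free_action_single W.add W.scale word_action_add scale_right_distrib)
qed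

lemma free_action_mult:
  assumes "\<And>g. endo (G g)"
  shows "free_action G (x * y) v = free_action G x (free_action G y v)"
proof (induction x rule: uq_free_induct)
  case 1
  show ?case by (simp add: free_action_0)
next
  case (2 x w c)
  then show ?case by (simp add: distrib_right free_action_add free_action_single free_action_single_mult[OF assms])
qed

text \<open>
  Endomorphisms satisfying the defining relations give a module structure, which is then
  the one in which the generators act as these endomorphisms.
\<close>

lemma Uq_module_exists:
  assumes G: "\<And>g. endo (G g)"
   and q: "q \<noteq> 0"
   and r: "\<And>v. G Gen_k (G Gen_kinv v) = v" "\<And>v. G Gen_kinv (G Gen_k v) = v"
    "\<And>v. G Gen_k (G Gen_e (G Gen_kinv v)) = scale (q^2) (G Gen_e v)"
    "\<And>v. G Gen_k (G Gen_f (G Gen_kinv v)) = scale (inverse (q^2)) (G Gen_f v)"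
    "\<And>v. G Gen_e (G Gen_f v) - G Gen_f (G Gen_e v) = scale (inverse (q - inverse q)) (G Gen_k v - G Gen_kinv v)"
  shows "\<exists>\<rho>. Uq_module q \<rho> \<and> (\<forall>g. \<rho> (uq_class q (uq_gen g)) = G g)"
proof -
  have evm: "free_action G (x - y) v = free_action G x v - free_action G y v" for x y v
    using free_action_add[of G "x - y" y v] by simp
  have evg: "free_action G (uq_gen g) v = G g v" for g v by (simp add: uq_gen_def free_action_single word_action_def)
  have evs: "free_action G (uq_scalar c) v = scale c v" for c v by (simp add: uq_scalar_def free_action_single word_action_def zero_uq_word_def)
  have ev1: "free_action G 1 v = v" for v using evs[of 1 v] by (simp add: uq_scalar_def)
  let ?N = "{x. free_action G x = (\<lambda>v. 0)}"
  interpret L: Vector_Spaces.linear scale scale "free_action G x" for x by (rule free_action_lin[OF G])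
  interpret LG: Vector_Spaces.linear scale scale "G g" for g by (rule G)
  interpret R: ring uq_free_ring by (rule uq_ring)
  have "ideal ?N uq_free_ring"
  proof (rule idealI[OF uq_ring])
    have inv: "m_inv (add_monoid uq_free_ring) a = - a" for a :: "'a uq_free"
      using R.minus_equality[of "-a" a] by (simp add: uq_free_ring_def a_inv_def)
    show "subgroup ?N (add_monoid uq_free_ring)"
      by (rule subgroup.intro, unfold inv) (auto simp: uq_free_ring_def free_action_add free_action_0 fun_eq_iff evm[of 0, simplified])
  qed (auto simp: uq_free_ring_def free_action_mult[OF G] fun_eq_iff L.zero)
  moreover have "uq_relators q \<subseteq> ?N"
    by (auto simp: uq_relators_def Let_def fun_eq_iff evm free_action_mult[OF G] evg evs ev1 r)
  ultimately have N: "uq_ideal q \<subseteq> ?N" unfolding uq_ideal_def by (rule R.genideal_minimal)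
  have eq: "free_action G x = free_action G y" if "uq_class q x = uq_class q y" for x y
    using that N unfolding uq_class_eq by (auto simp: fun_eq_iff evm)
  define \<rho> where "\<rho> C = free_action G (SOME x. uq_class q x = C)" for C
  have rho: "\<rho> (uq_class q x) = free_action G x" for x
    unfolding \<rho>_def by (rule eq, rule someI_ex) auto
  have car: "carrier (Uq_sl2 q) = range (uq_class q)"
    by (auto simp: Uq_sl2_def FactRing_def uq_class_def A_RCOSETS_def' uq_free_ring_def)
  have h: "uq_class q x \<otimes>\<^bsub>Uq_sl2 q\<^esub> uq_class q y = uq_class q (x * y)"
    "uq_class q x \<oplus>\<^bsub>Uq_sl2 q\<^esub> uq_class q y = uq_class q (x + y)"
    "\<one>\<^bsub>Uq_sl2 q\<^esub> = uq_class q 1" for x y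
    using uq_class_hom[of q] by (auto simp: ring_hom_def uq_free_ring_def)
  have "\<rho> \<in> ring_hom (Uq_sl2 q) End_ring"
    unfolding ring_hom_def car
    by (auto simp: h rho End_ring_def free_action_mult[OF G] free_action_add ev1 fun_eq_iff free_action_lin[OF G])
  then have "Uq_module q \<rho>" by (auto simp: Uq_module_def rho evs fun_eq_iff)
  then show ?thesis using rho evg by (intro exI[of _ \<rho>]) (auto simp: fun_eq_iff)
qed
end

end

theory Submission
  imports Defs
begin

text \<open>
  Write \<open>\<theta>\<^sub>i\<close> for the eigenvalues of \<open>A\<close> and \<open>t\<^sub>i = q\<^bsup>d-2i+1\<^esup> + q\<^bsup>2i-d-1\<^esup>\<close>. On the
  split space \<open>U\<^sub>i\<close> the map \<open>R\<close> is \<open>A - \<theta>\<^sub>i\<close>; it sends \<open>U\<^sub>i\<close> to \<open>U\<^sub>i\<^sub>+\<^sub>1\<close>, while \<open>\<psi>\<close> sends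
  \<open>U\<^sub>i\<^sub>+\<^sub>1\<close> to \<open>U\<^sub>i\<close> and \<open>U\<^sub>0 = K\<^sub>0\<close> to \<open>0\<close>. The two expressions for the Casimir element
  say that \<open>\<Lambda> = \<psi> R + t\<^sub>i\<^sub>+\<^sub>1 = R \<psi> + t\<^sub>i\<close> on \<open>U\<^sub>i\<close>.

  One inclusion is formal: \<open>\<Lambda>\<close> is \<open>t\<^sub>k\<close> on \<open>K\<^sub>k\<close>, because \<open>\<psi>\<close> vanishes there, and \<open>\<Lambda>\<close>
  commutes with \<open>A\<close>, so it is \<open>t\<^sub>k\<close> on \<open>M K\<^sub>k\<close>.

  For the other inclusion, the solution space of \<open>\<Lambda> v = t\<^sub>k v\<close> is invariant under \<open>K\<close>,
  hence is the sum of its intersections with the \<open>U\<^sub>i\<close>, and one may take \<open>v \<in> U\<^sub>i\<close>.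
  Then \<open>\<psi> R v = (t\<^sub>k - t\<^sub>i\<^sub>+\<^sub>1) v\<close> and \<open>R \<psi> v = (t\<^sub>k - t\<^sub>i) v\<close>. As \<open>t\<^sub>i = t\<^sub>k\<close> only for
  \<open>i = k\<close> and \<open>i = d + 1 - k\<close>, the first scalar vanishes only for \<open>i = k - 1\<close> and
  \<open>i = d - k\<close>, the second only for \<open>i = k\<close> and \<open>i = d - k + 1\<close>: away from the boundary of
  the string \<open>k \<le> i \<le> d - k\<close> that starts at \<open>K\<^sub>k\<close>, the vector \<open>v\<close> can be recovered
  from \<open>R v\<close> and from \<open>\<psi> v\<close>.

  \<^item> Above the string (\<open>i > d - k\<close>) repeated application of \<open>R\<close> loses nothing but ends
    in \<open>U\<^sub>d\<^sub>+\<^sub>1 = 0\<close>, so \<open>v = 0\<close> (\<open>eigenvector_above_string\<close>).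
  \<^item> Below it (\<open>i < k\<close>) repeated application of \<open>\<psi>\<close> loses nothing but ends in \<open>0\<close>,
    so again \<open>v = 0\<close> (\<open>eigenvector_below_string\<close>).
  \<^item> At its start (\<open>i = k\<close>) the vector \<open>R\<^bsup>d-2k+1\<^esup> v\<close> lies above the string, hence is zero;
    this says \<open>(A - \<theta>\<^sub>d\<^sub>-\<^sub>k) \<cdots> (A - \<theta>\<^sub>k) v = 0\<close>, that is, \<open>v \<in> K\<^sub>k\<close>
    (\<open>eigenvector_start_of_string\<close>).
  \<^item> Further along (\<open>k < i \<le> d - k\<close>) \<open>v\<close> is a multiple of \<open>R (\<psi> v)\<close>, and induction on \<open>i\<close>
    applies to \<open>\<psi> v\<close> (\<open>eigenvector_in_MK\<close>).

  The structural input is \<open>V = \<Sum> U\<^sub>i\<close>, which follows from irreducibility, as this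
  sum is invariant under \<open>A\<close> and \<open>A\<^sup>*\<close> (\<open>split_decomposition\<close>). The \<open>U\<^sub>i\<close> are the
  eigenspaces of \<open>K\<close> because \<open>K\<close> acts on them by distinct scalars. That these scalars,
  and the \<open>t\<^sub>i\<close> up to the reflection \<open>i \<mapsto> d + 1 - i\<close>, are distinct is inherited from the
  distinctness of the \<open>\<theta>\<^sub>i\<close>, which forces \<open>q\<^bsup>2n\<^esup> \<noteq> 1\<close> for \<open>1 \<le> n \<le> d\<close>.
\<close>

section \<open>Sums of subspaces and eigencomponents\<close>

context lin_space
begin

text \<open>
  Applying \<open>X - c\<^sub>j\<close> to the sum kills the \<open>j\<close>th component, rescales the others by
  nonzero scalars and stays in \<open>Z\<close>, so the components can be removed one at a time.
\<close>

lemma eigencomponents_in_invariant_subspace: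
  assumes X: "endo X" and Z: "subspace Z" "X ` Z \<subseteq> Z"
    and I: "finite I" "inj_on c I"
    and v: "\<And>i. i \<in> I \<Longrightarrow> X (v i) = scale (c i) (v i)" "(\<Sum>i\<in>I. v i) \<in> Z"
    and i: "i \<in> I"
  shows "v i \<in> Z"
proof -
  interpret X: Vector_Spaces.linear scale scale X by (rule X)
  have "\<forall>i\<in>I. v i \<in> Z"
    using I v
  proof (induction I arbitrary: v rule: finite_induct)
    case empty
    then show ?case by simp
  next
    case (insert j I)
    let ?s = "\<Sum>i\<in>insert j I. v i"
    define w where "w i = scale (c i - c j) (v i)" for i
    have Xw: "X (w i) = scale (c i) (w i)" if "i \<in> I" for i
      using insert.prems(2)[of i] that by (simp add: w_def X.scale mult.commute)
    have "X ?s = (\<Sum>i\<in>insert j I. scale (c i) (v i))"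
      unfolding X.sum using insert.prems(2) by (intro sum.cong) auto
    then have "X ?s - scale (c j) ?s = (\<Sum>i\<in>insert j I. scale (c i - c j) (v i))"
      by (simp only: scale_sum_right scale_left_diff_distrib sum_subtractf)
    also have "\<dots> = (\<Sum>i\<in>I. w i)"
      using insert.hyps by (simp add: w_def)
    finally have "(\<Sum>i\<in>I. w i) = X ?s - scale (c j) ?s" ..
    also have "\<dots> \<in> Z"
      using insert.prems(3) Z by (intro subspace_diff subspace_scale) auto
    finally have wZ: "\<forall>i\<in>I. w i \<in> Z"
      using insert.IH[of w] insert.prems(1) Xw by auto
    have vI: "v i \<in> Z" if "i \<in> I" for i
    proof -
      have "c i - c j \<noteq> 0"
        using insert.prems(1) insert.hyps(2) that by (auto simp: inj_on_def)
      then have "v i = scale (inverse (c i - c j)) (w i)"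
        by (simp add: w_def)
      then show ?thesis
        using wZ that Z(1) subspace_scale by auto
    qed
    have "v j = ?s - (\<Sum>i\<in>I. v i)"
      using insert.hyps by simp
    also have "\<dots> \<in> Z"
      by (rule subspace_diff[OF Z(1) insert.prems(3) subspace_sum[OF Z(1) vI]])
    finally show ?case
      using vI by simp
  qed
  then show ?thesis using i by simp
qed

lemma subspace_sum_spaces: "subspace (sum_spaces W J)"
  by (simp add: sum_spaces_def)

lemma sum_spaces_mono: "J \<subseteq> J' \<Longrightarrow> sum_spaces W J \<subseteq> sum_spaces W J'"
  unfolding sum_spaces_def by (intro span_mono) auto

lemma sum_spaces_superset: "j \<in> J \<Longrightarrow> W j \<subseteq> sum_spaces W J"
  unfolding sum_spaces_def using span_superset by blast

lemma sum_spaces_map: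
  assumes X: "endo X" and S: "subspace S"
    and J: "\<And>j u. j \<in> J \<Longrightarrow> u \<in> W j \<Longrightarrow> X u \<in> S"
    and v: "v \<in> sum_spaces W J"
  shows "X v \<in> S"
proof -
  interpret X: Vector_Spaces.linear scale scale X by (rule X)
  have "X ` span (\<Union>j\<in>J. W j) = span (X ` (\<Union>j\<in>J. W j))"
    by (simp add: X.span_image)
  also have "\<dots> \<subseteq> S"
    using J by (intro span_minimal S) auto
  finally show ?thesis
    using v by (auto simp: sum_spaces_def)
qed

lemma sum_spaces_components:
  assumes J: "finite J" and W: "\<And>j. j \<in> J \<Longrightarrow> subspace (W j)" and v: "v \<in> sum_spaces W J"
  obtains w where "\<And>j. j \<in> J \<Longrightarrow> w j \<in> W j" "v = (\<Sum>j\<in>J. w j)"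
proof -
  let ?S = "{v. \<exists>w. (\<forall>j\<in>J. w j \<in> W j) \<and> v = (\<Sum>j\<in>J. w j)}"
  have "subspace ?S"
  proof (rule subspaceI)
    show "0 \<in> ?S"
      using W by (auto intro!: exI[of _ "\<lambda>_. 0"] subspace_0)
    show "x + y \<in> ?S" if x: "x \<in> ?S" and y: "y \<in> ?S" for x y
    proof -
      obtain w w' where "\<forall>j\<in>J. w j \<in> W j" "x = sum w J" "\<forall>j\<in>J. w' j \<in> W j" "y = sum w' J"
        using x y by auto
      then show ?thesis
        using W by (auto intro!: exI[of _ "\<lambda>j. w j + w' j"] subspace_add simp: sum.distrib)
    qed
    show "scale c x \<in> ?S" if x: "x \<in> ?S" for c x
    proof -
      obtain w where "\<forall>j\<in>J. w j \<in> W j" "x = sum w J"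
        using x by auto
      then show ?thesis
        using W by (auto intro!: exI[of _ "\<lambda>j. scale c (w j)"] subspace_scale simp: scale_sum_right)
    qed
  qed
  moreover have "W j \<subseteq> ?S" if j: "j \<in> J" for j
  proof
    fix x assume x: "x \<in> W j"
    have "x = (\<Sum>i\<in>J. if i = j then x else 0)"
      using J j by simp
    then show "x \<in> ?S"
      using x W by (auto intro!: exI[of _ "\<lambda>i. if i = j then x else 0"] subspace_0)
  qed
  ultimately have "sum_spaces W J \<subseteq> ?S"
    unfolding sum_spaces_def by (intro span_minimal) auto
  then show ?thesis
    using v that by auto
qed

lemma endo_minus_scale:
  assumes "endo X"
  shows "endo (\<lambda>v. X v - scale c v)"
proof -
  interpret X: Vector_Spaces.linear scale scale X by (rule assms)
  show ?thesis
    by unfold_locales (auto simp: X.add X.scale scale_right_distrib scale_right_diff_distrib mult.commute)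
qed

lemma subspace_eq_scale:
  assumes "endo X"
  shows "subspace {v. X v = scale c v}"
proof -
  interpret X: Vector_Spaces.linear scale scale X by (rule assms)
  show ?thesis
    by (rule subspaceI) (auto simp: X.zero X.add X.scale scale_right_distrib mult.commute)
qed

lemma sum_eigenspaces_shift:
  assumes X: "endo X" and W: "\<And>j u. j \<in> J \<Longrightarrow> u \<in> W j \<Longrightarrow> X u = scale (c j) u"
    and v: "v \<in> sum_spaces W J"
  shows "X v - scale (c i) v \<in> sum_spaces W (J - {i})"
proof (rule sum_spaces_map[OF endo_minus_scale[OF X] subspace_sum_spaces _ v])
  fix j u assume j: "j \<in> J" "u \<in> W j"
  then have eq: "X u - scale (c i) u = scale (c j - c i) u"
    using W by (simp add: scale_left_diff_distrib)
  show "X u - scale (c i) u \<in> sum_spaces W (J - {i})"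
  proof (cases "j = i")
    case True
    then show ?thesis
      using eq subspace_0[OF subspace_sum_spaces] by simp
  next
    case False
    then have "u \<in> sum_spaces W (J - {i})"
      using j sum_spaces_superset[of j "J - {i}" W] by auto
    then show ?thesis
      unfolding eq by (rule subspace_scale[OF subspace_sum_spaces])
  qed
qed

lemma standard_ordering_neighbours:
  assumes B: "endo B" and W: "standard_ordering A B d W"
    and J: "J \<subseteq> {..d}" "\<And>j. j \<in> J \<Longrightarrow> {j - 1..j + 1} \<inter> {..d} \<subseteq> J'"
    and v: "v \<in> sum_spaces W J"
  shows "B v \<in> sum_spaces W J'"
proof (rule sum_spaces_map[OF B subspace_sum_spaces _ v])
  fix j u assume j: "j \<in> J" "u \<in> W j"
  then have "B u \<in> sum_spaces W ({j - 1..j + 1} \<inter> {..d})"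
    using W J(1) unfolding standard_ordering_def by blast
  then show "B u \<in> sum_spaces W J'"
    using sum_spaces_mono[OF J(2)[OF j(1)]] by blast
qed

section \<open>TD systems and the split decomposition\<close>

text \<open>
  Diagonalizability reduces the inclusion of the range in \<open>W\<close> to eigenvectors, and each of
  these is either fixed or killed by \<open>P\<close>.
\<close>

lemma range_primitive_idempotent:
  assumes X: "diagonalizable X" and P: "primitive_idempotent X W P"
  shows "range P = W"
proof -
  interpret P: Vector_Spaces.linear scale scale P
    using P by (simp add: primitive_idempotent_def)
  have W: "subspace W"
    using P by (auto simp: primitive_idempotent_def is_eigenspace_def eigenspace_with_eigenvalue_def)
  have img: "P u \<in> W" if U: "is_eigenspace X U" "u \<in> U" for U u
  proof (cases "U = W")
    case True
    then show ?thesis using P U by (auto simp: primitive_idempotent_def)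
  next
    case False
    then have "u \<in> span (\<Union>{U. is_eigenspace X U \<and> U \<noteq> W})"
      using U by (auto intro: span_base)
    then have "P u = 0"
      using P by (auto simp: primitive_idempotent_def)
    then show ?thesis
      using subspace_0[OF W] by auto
  qed
  have "P ` span (\<Union>{U. is_eigenspace X U}) \<subseteq> W"
    using img by (subst P.span_image[symmetric]) (intro span_minimal W, auto)
  then have "range P \<subseteq> W"
    using X by (simp add: diagonalizable_def)
  moreover have "W \<subseteq> range P"
    using P by (auto simp: primitive_idempotent_def) (metis rangeI)
  ultimately show ?thesis by blast
qed

lemma standard_ordering_range:
  assumes A: "diagonalizable A" and E: "standard_idempotents A B d E"
  shows "standard_ordering A B d (\<lambda>i. range (E i))"
proof -
  obtain W where W: "standard_ordering A B d W" "\<And>i. i \<le> d \<Longrightarrow> primitive_idempotent A (W i) (E i)"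
    using E by (auto simp: standard_idempotents_def)
  have eq: "range (E i) = W i" if "i \<le> d" for i
    using range_primitive_idempotent[OF A W(2)[OF that]] .
  have "bij_betw (\<lambda>i. range (E i)) {..d} S \<longleftrightarrow> bij_betw W {..d} S" for S
    by (intro bij_betw_cong) (simp add: eq)
  moreover have "sum_spaces (\<lambda>i. range (E i)) (J \<inter> {..d}) = sum_spaces W (J \<inter> {..d})" for J
    unfolding sum_spaces_def using eq by (intro arg_cong[of _ _ span]) auto
  ultimately show ?thesis
    using W(1) unfolding standard_ordering_def by (simp only: eq simp_thms cong: imp_cong)
qed

lemma standard_ordering_spans:
  assumes "diagonalizable A" "standard_ordering A B d W"
  shows "sum_spaces W {..d} = UNIV"
  using assms by (auto simp: diagonalizable_def standard_ordering_def sum_spaces_def bij_betw_def)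

end

text \<open>
  The eigenvalue sequences are named but arbitrary, so the split decomposition and its
  ladder structure are obtained for every TD system.
\<close>
locale td_eigen = lin_space scale
  for scale :: "'a::field \<Rightarrow> 'b::ab_group_add \<Rightarrow> 'b" +
  fixes d :: nat and A As :: "'b \<Rightarrow> 'b" and E Es :: "nat \<Rightarrow> 'b \<Rightarrow> 'b" and \<theta> \<theta>s :: "nat \<Rightarrow> 'a"
  assumes TD: "TD_system d A E As Es"
    and eigenvalue: "\<And>i. i \<le> d \<Longrightarrow> eigenspace_with_eigenvalue A (range (E i)) (\<theta> i)"
    and dual_eigenvalue: "\<And>i. i \<le> d \<Longrightarrow> eigenspace_with_eigenvalue As (range (Es i)) (\<theta>s i)"
begin

abbreviation "EV \<equiv> sum_spaces (\<lambda>j. range (E j))"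
abbreviation "EsV \<equiv> sum_spaces (\<lambda>j. range (Es j))"
abbreviation "U \<equiv> split_U d E Es"

lemma endo_A: "endo A" and endo_As: "endo As"
  and diag_A: "diagonalizable A" and diag_As: "diagonalizable As"
  using TD by (auto simp: TD_system_def TD_pair_def)

sublocale A: Vector_Spaces.linear scale scale A by (rule endo_A)
sublocale As: Vector_Spaces.linear scale scale As by (rule endo_As)

lemma standard: "standard_ordering A As d (\<lambda>i. range (E i))"
  and dual_standard: "standard_ordering As A d (\<lambda>i. range (Es i))"
  using TD diag_A diag_As by (auto simp: TD_system_def intro: standard_ordering_range)

lemma range_E: "i \<le> d \<Longrightarrow> range (E i) = {v. A v = scale (\<theta> i) v}"
  and range_Es: "i \<le> d \<Longrightarrow> range (Es i) = {v. As v = scale (\<theta>s i) v}"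
  using eigenvalue dual_eigenvalue by (auto simp: eigenspace_with_eigenvalue_def)

lemma inj_eigenvalue: "inj_on \<theta> {..d}"
proof (rule inj_onI)
  fix i j assume ij: "i \<in> {..d}" "j \<in> {..d}" "\<theta> i = \<theta> j"
  then have "range (E i) = range (E j)"
    by (simp add: range_E)
  then show "i = j"
    using standard ij by (auto simp: standard_ordering_def bij_betw_def dest: inj_onD)
qed

lemma irreducible:
  "subspace W \<Longrightarrow> A ` W \<subseteq> W \<Longrightarrow> As ` W \<subseteq> W \<Longrightarrow> W \<noteq> {0} \<Longrightarrow> W = UNIV"
  using TD unfolding TD_system_def TD_pair_def by blast

lemma A_EV:
  assumes "v \<in> EV {i..d}"
  shows "A v - scale (\<theta> i) v \<in> EV {Suc i..d}"
proof -
  have "A v - scale (\<theta> i) v \<in> EV ({i..d} - {i})"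
    by (rule sum_eigenspaces_shift[OF endo_A _ assms]) (auto simp: range_E)
  moreover have "{i..d} - {i} = {Suc i..d}"
    by auto
  ultimately show ?thesis by simp
qed

lemma A_EsV:
  assumes "i \<le> d" "v \<in> EsV {0..i}"
  shows "A v \<in> EsV {0..Suc i}"
  using assms by (intro standard_ordering_neighbours[OF endo_A dual_standard, of "{0..i}"]) auto

lemma As_EsV:
  assumes "i \<le> d" "v \<in> EsV {0..i}"
  shows "As v - scale (\<theta>s i) v \<in> EsV {0..<i}"
proof -
  have "As v - scale (\<theta>s i) v \<in> EsV ({0..i} - {i})"
    by (rule sum_eigenspaces_shift[OF endo_As _ assms(2)]) (use assms(1) in \<open>auto simp: range_Es\<close>)
  moreover have "{0..i} - {i} = {0..<i}"
    by auto
  ultimately show ?thesis by simp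
qed

lemma As_EV:
  assumes "v \<in> EV {i..d}"
  shows "As v \<in> EV {i - 1..d}"
  using assms by (intro standard_ordering_neighbours[OF endo_As standard, of "{i..d}"]) auto

lemma subspace_U: "subspace (U i)"
  unfolding split_U_def by (intro subspace_inter subspace_sum_spaces)

lemma U_beyond: "U (Suc d) = {0}"
  using subspace_0[OF subspace_sum_spaces] by (auto simp: split_U_def sum_spaces_def[of _ "{}"])

text \<open>
  \<open>A - \<theta>\<^sub>i\<close> kills the first summand of \<open>E\<^sub>iV + \<cdots> + E\<^sub>dV\<close>, and by tridiagonality it
  extends the dual flag by at most one step. With the roles of the two flags exchanged,
  \<open>A\<^sup>* - \<theta>\<^sup>*\<^sub>i\<close> lowers.
\<close>
lemma A_raises:
  assumes i: "i \<le> d" and v: "v \<in> U i"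
  shows "A v - scale (\<theta> i) v \<in> U (Suc i)"
proof -
  have v': "v \<in> EsV {0..i}" "v \<in> EV {i..d}"
    using v by (auto simp: split_U_def)
  have "v \<in> EsV {0..Suc i}"
    using v'(1) sum_spaces_mono[of "{0..i}" "{0..Suc i}"] by auto
  then have "A v - scale (\<theta> i) v \<in> EsV {0..Suc i}"
    using A_EsV[OF i v'(1)] by (intro subspace_diff subspace_scale subspace_sum_spaces)
  then show ?thesis
    using A_EV[OF v'(2)] by (simp add: split_U_def)
qed

lemma A_top: "v \<in> U d \<Longrightarrow> A v = scale (\<theta> d) v"
  using A_raises[of d v] U_beyond by auto

lemma As_lowers:
  assumes i: "i \<le> d" and v: "v \<in> U i"
  shows "As v - scale (\<theta>s i) v \<in> U (i - 1)"
proof -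
  have v': "v \<in> EsV {0..i}" "v \<in> EV {i..d}"
    using v by (auto simp: split_U_def)
  have "v \<in> EV {i - 1..d}"
    using v'(2) sum_spaces_mono[of "{i..d}" "{i - 1..d}"] by auto
  then have "As v - scale (\<theta>s i) v \<in> EV {i - 1..d}"
    using As_EV[OF v'(2)] by (intro subspace_diff subspace_scale subspace_sum_spaces)
  moreover have "EsV {0..<i} \<subseteq> EsV {0..i - 1}"
    by (intro sum_spaces_mono) auto
  ultimately show ?thesis
    using As_EsV[OF i v'(1)] by (auto simp: split_U_def)
qed

text \<open>
  The sum of the \<open>U\<^sub>i\<close> is stable under \<open>A\<close> (which raises modulo scalars) and \<open>A\<^sup>*\<close> (which
  lowers modulo scalars), and it contains \<open>U\<^sub>0 = E\<^sup>*\<^sub>0V \<noteq> 0\<close>; irreducibility does the rest.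
\<close>
lemma split_decomposition: "sum_spaces U {..d} = UNIV"
proof (rule irreducible)
  let ?S = "sum_spaces U {..d}"
  have U: "v \<in> ?S" if "i \<le> d" "v \<in> U i" for i v
    using that sum_spaces_superset[of i "{..d}" U] by auto
  show S: "subspace ?S"
    by (rule subspace_sum_spaces)
  have "A v \<in> ?S" if i: "i \<le> d" and v: "v \<in> U i" for i v
  proof -
    have "A v - scale (\<theta> i) v \<in> ?S"
    proof (cases "i = d")
      case True
      then show ?thesis using A_top v subspace_0[OF S] by simp
    next
      case False
      then show ?thesis using U[of "Suc i"] A_raises[OF i v] i by simp
    qed
    then have "A v - scale (\<theta> i) v + scale (\<theta> i) v \<in> ?S"
      using S U[OF i v] by (intro subspace_add subspace_scale)
    then show ?thesis by simp
  qed
  then show "A ` ?S \<subseteq> ?S"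
    using sum_spaces_map[OF endo_A S, of "{..d}" U] by auto
  have "As v \<in> ?S" if i: "i \<le> d" and v: "v \<in> U i" for i v
  proof -
    have "As v - scale (\<theta>s i) v \<in> ?S"
      using U[of "i - 1"] As_lowers[OF i v] i by simp
    then have "As v - scale (\<theta>s i) v + scale (\<theta>s i) v \<in> ?S"
      using S U[OF i v] by (intro subspace_add subspace_scale)
    then show ?thesis by simp
  qed
  then show "As ` ?S \<subseteq> ?S"
    using sum_spaces_map[OF endo_As S, of "{..d}" U] by auto
  have "range (Es 0) \<noteq> {0}" "subspace (range (Es 0))"
    using dual_eigenvalue[of 0] unfolding eigenspace_with_eigenvalue_def by blast+
  then obtain v where v: "v \<in> range (Es 0)" "v \<noteq> 0"
    using subspace_0 by blast
  have "EV {0..d} = UNIV"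
    using standard_ordering_spans[OF diag_A standard] by (simp add: atLeast0AtMost)
  then have "v \<in> U 0"
    using v(1) sum_spaces_superset[of 0 "{0..0}" "\<lambda>j. range (Es j)"] by (auto simp: split_U_def)
  then show "?S \<noteq> {0}"
    using U[of 0 v] v(2) by auto
qed

lemma endo_eqI_on_U:
  assumes "endo X" "endo Y" and eq: "\<And>i v. i \<le> d \<Longrightarrow> v \<in> U i \<Longrightarrow> X v = Y v"
  shows "X v = Y v"
proof -
  interpret X: Vector_Spaces.linear scale scale X by (rule assms)
  interpret Y: Vector_Spaces.linear scale scale Y by (rule assms)
  have "sum_spaces U {..d} \<subseteq> {v. X v = Y v}"
    unfolding sum_spaces_def
    by (intro span_minimal subspaceI) (auto simp: eq X.add Y.add X.scale Y.scale X.zero Y.zero)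
  then show ?thesis
    using split_decomposition by auto
qed

lemma split_K_0: "split_K d E Es 0 = U 0"
  by (simp add: split_K_def split_U_def)

text \<open>
  The product \<open>(A - \<theta>\<^sub>k\<^sub>+\<^sub>m\<^sub>-\<^sub>1) \<cdots> (A - \<theta>\<^sub>k)\<close>. It is both the map from \<open>U\<^sub>k\<close> up to
  \<open>U\<^sub>k\<^sub>+\<^sub>m\<close> and the polynomial in \<open>A\<close> that annihilates \<open>E\<^sub>kV + \<cdots> + E\<^sub>k\<^sub>+\<^sub>m\<^sub>-\<^sub>1V\<close>; the
  description of \<open>K\<^sub>k\<close> inside \<open>U\<^sub>k\<close> rests on this coincidence.
\<close>
primrec raise :: "nat \<Rightarrow> nat \<Rightarrow> 'b \<Rightarrow> 'b" where
  "raise k 0 v = v"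
| "raise k (Suc m) v = A (raise k m v) - scale (\<theta> (k + m)) (raise k m v)"

lemma endo_raise: "endo (raise k m)"
proof (induction m)
  case 0
  then show ?case by (simp add: linear_id[unfolded id_def])
next
  case (Suc m)
  have "endo ((\<lambda>v. A v - scale (\<theta> (k + m)) v) \<circ> raise k m)"
    by (rule Vector_Spaces.linear_compose[OF Suc endo_minus_scale[OF endo_A]])
  then show ?case by (simp add: o_def)
qed

lemma raise_A: "raise k m (A v) = A (raise k m v)"
  by (induction m) (simp_all add: A.diff A.scale)

lemma raise_eigenvector:
  "A v = scale c v \<Longrightarrow> raise k m v = scale (\<Prod>j<m. c - \<theta> (k + j)) v"
  by (induction m) (simp_all add: A.scale scale_left_diff_distrib algebra_simps
      flip: scale_left_diff_distrib)

lemma raise_in_U: "k + m \<le> Suc d \<Longrightarrow> v \<in> U k \<Longrightarrow> raise k m v \<in> U (k + m)"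
  by (induction m) (simp_all add: A_raises)

text \<open>
  The kernel is \<open>A\<close>-invariant, so it contains the components of \<open>v\<close> in the eigenspaces
  of \<open>A\<close>. On the component in \<open>E\<^sub>jV\<close> the product acts by a scalar which is nonzero
  unless \<open>k \<le> j < k + m\<close>, as the eigenvalues are distinct.
\<close>
lemma raise_eq_0_imp_EV:
  assumes v: "raise k m v = 0" and m: "k + m \<le> Suc d"
  shows "v \<in> EV {k..<k + m}"
proof -
  interpret r: Vector_Spaces.linear scale scale "raise k m" by (rule endo_raise)
  let ?Z = "{v. raise k m v = 0}"
  have Z: "subspace ?Z"
    by (rule subspaceI) (auto simp: r.add r.scale r.zero)
  have "v \<in> EV {..d}"
    using standard_ordering_spans[OF diag_A standard] by simp
  moreover have "subspace (range (E j))" if "j \<in> {..d}" for j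
    using eigenvalue[of j] that unfolding eigenspace_with_eigenvalue_def by blast
  ultimately obtain w where w: "\<And>j. j \<in> {..d} \<Longrightarrow> w j \<in> range (E j)" "v = (\<Sum>j\<le>d. w j)"
    using sum_spaces_components[of "{..d}" "\<lambda>j. range (E j)" v] by blast
  have Aw: "A (w j) = scale (\<theta> j) (w j)" if "j \<in> {..d}" for j
    using w(1)[OF that] that range_E[of j] by simp
  have "w j \<in> ?Z" if "j \<in> {..d}" for j
  proof (rule eigencomponents_in_invariant_subspace[OF endo_A Z _ _ inj_eigenvalue Aw _ that])
    show "A ` ?Z \<subseteq> ?Z"
      by (auto simp: raise_A A.zero)
  qed (use v w(2) in simp_all)
  then have zero: "scale (\<Prod>i<m. \<theta> j - \<theta> (k + i)) (w j) = 0" if "j \<le> d" for j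
    using that Aw raise_eigenvector[of "w j" "\<theta> j" k m] by simp
  have "w j \<in> EV {k..<k + m}" if j: "j \<le> d" for j
  proof (cases "j \<in> {k..<k + m}")
    case True
    then show ?thesis
      using sum_spaces_superset[of j "{k..<k + m}" "\<lambda>j. range (E j)"] w(1)[of j] j by auto
  next
    case False
    have "\<theta> j \<noteq> \<theta> (k + i)" if "i < m" for i
      using inj_onD[OF inj_eigenvalue, of j "k + i"] that False j m by auto
    then have "(\<Prod>i<m. \<theta> j - \<theta> (k + i)) \<noteq> 0"
      by simp
    then have "w j = 0"
      using zero[OF j] by (metis scale_eq_0_iff)
    then show ?thesis
      using subspace_0[OF subspace_sum_spaces] by simp
  qed
  then show ?thesis
    unfolding w(2) by (intro subspace_sum subspace_sum_spaces) auto
qed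

lemma raise_eq_0_imp_split_K:
  assumes k: "2 * k \<le> d" and v: "v \<in> U k" "raise k (d - 2 * k + 1) v = 0"
  shows "v \<in> split_K d E Es k"
proof -
  have "{k..<k + (d - 2 * k + 1)} = {k..d - k}"
    using k by auto
  then show ?thesis
    using raise_eq_0_imp_EV[OF v(2)] k v(1) by (auto simp: split_K_def split_U_def)
qed

lemma split_K_subset_U: "split_K d E Es i \<subseteq> U i"
  using sum_spaces_mono[of "{i..d - i}" "{i..d}" "\<lambda>j. range (E j)"]
  by (auto simp: split_K_def split_U_def)

section \<open>The submodule generated by a space under the algebra generated by A\<close>
lemma subspace_MK: "subspace (MK d A E Es i)"
  unfolding MK_def generated_submodule_def hull_def by (auto intro!: subspace_Inter)

lemma split_K_subset_MK: "split_K d E Es i \<subseteq> MK d A E Es i"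
  unfolding MK_def generated_submodule_def by (rule hull_subset)

lemma A_in_generated: "A \<in> generated_subalgebra A"
  unfolding generated_subalgebra_def by (rule hull_inc) simp

lemma A_MK: "v \<in> MK d A E Es i \<Longrightarrow> A v \<in> MK d A E Es i"
  using A_in_generated unfolding MK_def generated_submodule_def hull_def by blast

text \<open>
  The endomorphisms that preserve \<open>Z\<close> form a subalgebra, so invariance under the
  generator \<open>A\<close> already gives invariance under the whole algebra.
\<close>
lemma MK_minimal:
  assumes Z: "subspace Z" "A ` Z \<subseteq> Z" and K: "split_K d E Es i \<subseteq> Z"
  shows "MK d A E Es i \<subseteq> Z"
proof -
  have "subalgebra_End {X. endo X \<and> X ` Z \<subseteq> Z}"
    unfolding subalgebra_End_def
  proof (intro conjI ballI allI subsetI)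
    fix X Y assume XY: "X \<in> {X. endo X \<and> X ` Z \<subseteq> Z}" "Y \<in> {X. endo X \<and> X ` Z \<subseteq> Z}"
    interpret X: Vector_Spaces.linear scale scale X using XY by simp
    interpret Y: Vector_Spaces.linear scale scale Y using XY by simp
    have "endo (\<lambda>v. X v + Y v)"
      by unfold_locales (auto simp: X.add Y.add X.scale Y.scale scale_right_distrib)
    then show "(\<lambda>v. X v + Y v) \<in> {X. endo X \<and> X ` Z \<subseteq> Z}"
      using XY Z by (auto intro!: subspace_add)
    have "endo (X \<circ> Y)"
      by (rule Vector_Spaces.linear_compose) (use XY in auto)
    then show "X \<circ> Y \<in> {X. endo X \<and> X ` Z \<subseteq> Z}"
      using XY by (auto simp: image_subset_iff)
  next
    fix c X assume X: "X \<in> {X. endo X \<and> X ` Z \<subseteq> Z}"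
    interpret X: Vector_Spaces.linear scale scale X using X by simp
    have "endo (\<lambda>v. scale c (X v))"
      by unfold_locales (auto simp: X.add X.scale scale_right_distrib mult.commute)
    then show "(\<lambda>v. scale c (X v)) \<in> {X. endo X \<and> X ` Z \<subseteq> Z}"
      using X Z by (auto intro!: subspace_scale)
  qed (auto simp: linear_id)
  then have "generated_subalgebra A \<subseteq> {X. endo X \<and> X ` Z \<subseteq> Z}"
    unfolding generated_subalgebra_def by (intro hull_minimal) (auto simp: endo_A Z[unfolded image_subset_iff])
  then show ?thesis
    unfolding MK_def generated_submodule_def by (intro hull_minimal K conjI Z) auto
qed

end

section \<open>The grading by the eigenspaces of K\<close>
locale td_grading = td_eigen scale d A As E Es \<theta> \<theta>s
  for scale :: "'a::field \<Rightarrow> 'b::ab_group_add \<Rightarrow> 'b" and d A As E Es \<theta> \<theta>s +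
  fixes K :: "'b \<Rightarrow> 'b" and \<kappa> :: "nat \<Rightarrow> 'a"
  assumes endo_K: "endo K"
    and K_U: "\<And>i v. i \<le> d \<Longrightarrow> v \<in> U i \<Longrightarrow> K v = scale (\<kappa> i) v"
    and inj_kappa: "inj_on \<kappa> {..d}"
begin

sublocale K: Vector_Spaces.linear scale scale K by (rule endo_K)

text \<open>
  Since \<open>K\<close> separates the spaces \<open>U\<^sub>i\<close>, every \<open>K\<close>-invariant subspace is graded.
\<close>

lemma graded_components:
  assumes Z: "subspace Z" "K ` Z \<subseteq> Z" and v: "v \<in> Z"
  obtains u where "\<And>i. i \<le> d \<Longrightarrow> u i \<in> U i \<inter> Z" "v = (\<Sum>i\<le>d. u i)"
proof -
  have "v \<in> sum_spaces U {..d}"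
    by (simp add: split_decomposition)
  then obtain u where u: "\<And>i. i \<in> {..d} \<Longrightarrow> u i \<in> U i" "v = (\<Sum>i\<le>d. u i)"
    using sum_spaces_components[of "{..d}" U v] subspace_U by blast
  have "u i \<in> Z" if "i \<in> {..d}" for i
    using eigencomponents_in_invariant_subspace[OF endo_K Z _ inj_kappa, of u i] K_U u v that by auto
  then show ?thesis
    using that u by auto
qed

lemma K_eigenvector_in_U:
  assumes i: "i \<le> d" and v: "K v = scale (\<kappa> i) v"
  shows "v \<in> U i"
proof -
  let ?Z = "{v. K v = scale (\<kappa> i) v}"
  have "subspace ?Z"
    by (rule subspace_eq_scale[OF endo_K])
  moreover have "K ` ?Z \<subseteq> ?Z"
    by (auto simp: K.scale)
  ultimately obtain u where u: "\<And>j. j \<le> d \<Longrightarrow> u j \<in> U j \<inter> ?Z" "v = (\<Sum>j\<le>d. u j)"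
    using graded_components[of ?Z v] v by blast
  have "u j = 0" if "j \<in> {..d} - {i}" for j
  proof -
    have "K (u j) = scale (\<kappa> j) (u j)" "K (u j) = scale (\<kappa> i) (u j)"
      using u(1)[of j] K_U[of j "u j"] that by simp_all
    moreover have "\<kappa> j \<noteq> \<kappa> i"
      using inj_onD[OF inj_kappa, of j i] that i by auto
    ultimately show ?thesis by simp
  qed
  then have "v = u i"
    unfolding u(2) using i by (subst sum.remove[of _ i]) auto
  then show ?thesis
    using u(1)[OF i] by simp
qed

end

section \<open>Eigenspaces of the Casimir element\<close>

text \<open>
  The part of the \<open>U\<^sub>q(sl\<^sub>2)\<close>-module structure that determines the Casimir eigenspaces:
  \<open>L\<close> stands for the action of \<open>\<Lambda>\<close>, and \<open>t\<close> for its eigenvalues. The scalar at \<open>i\<close>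
  that \<open>\<psi> (A - \<theta>\<^sub>i)\<close> needs on \<open>U\<^sub>i\<close> is \<open>t\<^sub>i\<^sub>+\<^sub>1\<close>, and the one that \<open>(A - \<theta>\<^sub>i) \<psi>\<close> needs on
  \<open>U\<^sub>i\<^sub>+\<^sub>1\<close> is the same \<open>t\<^sub>i\<^sub>+\<^sub>1\<close>; therefore \<open>L\<close> commutes with both factors.
  The last two assumptions say that on \<open>0..d + 1\<close> two different indices have the same
  \<open>t\<close> exactly if the reflection \<open>i \<mapsto> d + 1 - i\<close> interchanges them.
\<close>
locale td_casimir = td_grading scale d A As E Es \<theta> \<theta>s K \<kappa>
  for scale :: "'a::field \<Rightarrow> 'b::ab_group_add \<Rightarrow> 'b" and d A As E Es \<theta> \<theta>s K \<kappa> +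
  fixes \<psi> L :: "'b \<Rightarrow> 'b" and t :: "nat \<Rightarrow> 'a"
  assumes endo_psi: "endo \<psi>" and endo_L: "endo L"
    and psi_U: "\<And>i v. i < d \<Longrightarrow> v \<in> U (Suc i) \<Longrightarrow> \<psi> v \<in> U i"
    and L_psi_raise: "\<And>i v. i \<le> d \<Longrightarrow> v \<in> U i \<Longrightarrow>
      L v = \<psi> (A v - scale (\<theta> i) v) + scale (t (Suc i)) v"
    and L_raise_psi: "\<And>i v. i < d \<Longrightarrow> v \<in> U (Suc i) \<Longrightarrow>
      L v = A (\<psi> v) - scale (\<theta> i) (\<psi> v) + scale (t (Suc i)) v"
    and L_split_K: "\<And>i v. 2 * i \<le> d \<Longrightarrow> v \<in> split_K d E Es i \<Longrightarrow> L v = scale (t i) v"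
    and t_reflect: "\<And>i. i \<le> Suc d \<Longrightarrow> t (Suc d - i) = t i"
    and t_distinct: "\<And>h k. h < k \<Longrightarrow> h + k \<le> d \<Longrightarrow> t h \<noteq> t k"
begin

sublocale psi: Vector_Spaces.linear scale scale \<psi> by (rule endo_psi)
sublocale L: Vector_Spaces.linear scale scale L by (rule endo_L)

lemma L_U:
  assumes i: "i \<le> d" and v: "v \<in> U i"
  shows "L v \<in> U i"
proof (cases "i = d")
  case True
  then have "L v = scale (t (Suc i)) v"
    using L_psi_raise[OF i v] A_top[of v] v by (simp add: psi.zero)
  then show ?thesis
    using v subspace_scale[OF subspace_U] by simp
next
  case False
  then have "\<psi> (A v - scale (\<theta> i) v) \<in> U i"
    using psi_U[of i] A_raises[OF i v] i by simp
  then show ?thesis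
    unfolding L_psi_raise[OF i v] using v by (intro subspace_add subspace_scale subspace_U)
qed

text \<open>
  On \<open>U\<^sub>i\<close> with \<open>i < d\<close> both \<open>L (A - \<theta>\<^sub>i)\<close> and \<open>(A - \<theta>\<^sub>i) L\<close> equal
  \<open>(A - \<theta>\<^sub>i) \<psi> (A - \<theta>\<^sub>i) + t\<^sub>i\<^sub>+\<^sub>1 (A - \<theta>\<^sub>i)\<close>; on \<open>U\<^sub>d\<close> the map \<open>A\<close> is a scalar.
\<close>
lemma L_commutes_A: "L (A v) = A (L v)"
proof -
  have "(L \<circ> A) v = (A \<circ> L) v"
  proof (rule endo_eqI_on_U[of "L \<circ> A" "A \<circ> L"])
    fix i v assume i: "i \<le> d" and v: "v \<in> U i"
    show "(L \<circ> A) v = (A \<circ> L) v"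
    proof (cases "i = d")
      case True
      then show ?thesis
        using A_top v L_U[OF i v] by (simp add: L.scale)
    next
      case False
      define w where "w = A v - scale (\<theta> i) v"
      have "L w = A (\<psi> w) - scale (\<theta> i) (\<psi> w) + scale (t (Suc i)) w"
        using L_raise_psi[of i w] A_raises[OF i v] i False by (simp add: w_def)
      moreover have "\<psi> w = L v - scale (t (Suc i)) v"
        using L_psi_raise[OF i v] by (simp add: w_def)
      ultimately have "L w = A (L v) - scale (\<theta> i) (L v)"
        by (simp add: A.diff A.scale scale_right_diff_distrib w_def mult.commute)
      then show ?thesis
        by (simp add: w_def L.diff L.scale)
    qed
  next
    show "endo (L \<circ> A)" "endo (A \<circ> L)"
      by (rule Vector_Spaces.linear_compose[OF endo_A endo_L]
          Vector_Spaces.linear_compose[OF endo_L endo_A])+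
  qed
  then show ?thesis by simp
qed

lemma L_commutes_K: "L (K v) = K (L v)"
proof -
  have "(L \<circ> K) v = (K \<circ> L) v"
  proof (rule endo_eqI_on_U[of "L \<circ> K" "K \<circ> L"])
    show "endo (L \<circ> K)" "endo (K \<circ> L)"
      by (rule Vector_Spaces.linear_compose[OF endo_K endo_L]
          Vector_Spaces.linear_compose[OF endo_L endo_K])+
  qed (simp add: K_U L_U L.scale)
  then show ?thesis by simp
qed

lemma L_commutes_psi:
  assumes i: "i < d" and v: "v \<in> U (Suc i)"
  shows "L (\<psi> v) = \<psi> (L v)"
  unfolding L_raise_psi[OF i v] using L_psi_raise[OF _ psi_U[OF i v]] i
  by (simp add: psi.add psi.scale)

text \<open>
  With \<open>R = A - \<theta>\<^sub>i\<close> on \<open>U\<^sub>i\<close>, the vector \<open>R v\<close> is again an eigenvector, one step higher, and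
  \<open>\<psi> R v = (t\<^sub>k - t\<^sub>i\<^sub>+\<^sub>1) v\<close> with \<open>t\<^sub>i\<^sub>+\<^sub>1 = t\<^sub>d\<^sub>-\<^sub>i \<noteq> t\<^sub>k\<close> since \<open>d - i < k\<close>. So \<open>v\<close> can be
  recovered from \<open>R v\<close>, which vanishes by descending induction from \<open>U\<^sub>d\<^sub>+\<^sub>1 = 0\<close>.
\<close>
lemma eigenvector_above_string:
  assumes k: "2 * k \<le> d"
  shows "d < i + k \<Longrightarrow> i \<le> Suc d \<Longrightarrow> v \<in> U i \<Longrightarrow> L v = scale (t k) v \<Longrightarrow> v = 0"
proof (induction "Suc d - i" arbitrary: i v)
  case 0
  then show ?case using U_beyond by auto
next
  case (Suc n)
  then have i: "i \<le> d" by simp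
  define w where "w = A v - scale (\<theta> i) v"
  have "w = 0"
  proof (rule Suc.hyps(1))
    show "w \<in> U (Suc i)"
      using A_raises[OF i] Suc.prems by (simp add: w_def)
    show "L w = scale (t k) w"
      using Suc.prems(4) by (simp add: w_def L.diff L.scale L_commutes_A A.scale scale_right_diff_distrib mult.commute)
  qed (use Suc i in auto)
  then have "scale (t k) v = scale (t (Suc i)) v"
    using L_psi_raise[OF i Suc.prems(3)] Suc.prems(4) by (simp add: w_def psi.zero)
  moreover have "t (Suc i) = t (d - i)"
    using t_reflect[of "Suc i"] i by simp
  moreover have "t (d - i) \<noteq> t k"
    using Suc.prems(1) k i by (intro t_distinct) auto
  ultimately show ?case by auto
qed

text \<open>
  The mirror image of the previous argument: \<open>v\<close> is recovered from \<open>\<psi> v\<close>. The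
  descent ends at \<open>U\<^sub>0 = K\<^sub>0\<close>, where \<open>L\<close> is the scalar \<open>t\<^sub>0 \<noteq> t\<^sub>k\<close>.
\<close>
lemma eigenvector_below_string:
  assumes k: "2 * k \<le> d"
  shows "i < k \<Longrightarrow> v \<in> U i \<Longrightarrow> L v = scale (t k) v \<Longrightarrow> v = 0"
proof (induction i arbitrary: v)
  case 0
  then have "scale (t 0) v = scale (t k) v"
    using L_split_K[of 0 v] split_K_0 by simp
  then show ?case
    using t_distinct[of 0 k] k 0 by auto
next
  case (Suc i)
  then have i: "i < d" using k by simp
  have "\<psi> v = 0"
    using Suc.IH[of "\<psi> v"] Suc.prems i psi_U[OF i] L_commutes_psi[OF i] by (simp add: psi.scale)
  then have "L v = scale (t (Suc i)) v"
    using L_raise_psi[OF i Suc.prems(2)] by (simp add: A.zero)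
  moreover have "t (Suc i) \<noteq> t k"
    using Suc.prems(1) k by (intro t_distinct) auto
  ultimately show ?case
    using Suc.prems(3) by simp
qed

text \<open>
  Raising \<open>d - 2k + 1\<close> times leads to \<open>U\<^sub>d\<^sub>-\<^sub>k\<^sub>+\<^sub>1\<close>, just above the string, where
  eigenvectors for \<open>t\<^sub>k\<close> vanish; the vanishing puts \<open>v\<close> into
  \<open>E\<^sub>kV + \<cdots> + E\<^sub>d\<^sub>-\<^sub>kV\<close>.
\<close>
lemma eigenvector_start_of_string:
  assumes k: "2 * k \<le> d" and v: "v \<in> U k" "L v = scale (t k) v"
  shows "v \<in> split_K d E Es k"
proof (rule raise_eq_0_imp_split_K[OF k v(1)])
  have "L (raise k m v) = scale (t k) (raise k m v)" for m
    using v(2) by (induction m) (simp_all add: L.diff L.scale L_commutes_A A.scale scale_right_diff_distrib mult.commute)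
  moreover have "raise k (d - 2 * k + 1) v \<in> U (k + (d - 2 * k + 1))"
    using k v(1) by (intro raise_in_U) auto
  ultimately show "raise k (d - 2 * k + 1) v = 0"
    using k by (intro eigenvector_above_string[OF k, of "k + (d - 2 * k + 1)"]) (auto simp del: raise.simps)
qed

lemma eigenvector_in_MK:
  assumes k: "2 * k \<le> d"
  shows "i \<le> d \<Longrightarrow> v \<in> U i \<Longrightarrow> L v = scale (t k) v \<Longrightarrow> v \<in> MK d A E Es k"
proof (induction i arbitrary: v)
  case 0
  show ?case
  proof (cases "k = 0")
    case True
    then show ?thesis
      using split_K_subset_MK[of 0] split_K_0 0 by auto
  next
    case False
    then have "v = 0"
      using eigenvector_below_string[OF k _ 0(2,3)] by simp
    then show ?thesis
      using subspace_0[OF subspace_MK] by simp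
  qed
next
  case (Suc i)
  then have i: "i < d" by simp
  consider "Suc i < k" | "Suc i = k" | "d < Suc i + k" | "k < Suc i" "Suc i + k \<le> d"
    by linarith
  then show ?case
  proof cases
    case 1
    then have "v = 0"
      using eigenvector_below_string[OF k] Suc.prems by blast
    then show ?thesis
      using subspace_0[OF subspace_MK] by simp
  next
    case 2
    then show ?thesis
      using eigenvector_start_of_string[OF k, of v] Suc.prems split_K_subset_MK[of k] by auto
  next
    case 3
    then have "v = 0"
      using eigenvector_above_string[OF k, of "Suc i" v] Suc.prems by auto
    then show ?thesis
      using subspace_0[OF subspace_MK] by simp
  next
    case 4
    \<comment> \<open>Here \<open>t\<^sub>k - t\<^sub>i\<^sub>+\<^sub>1\<close> is invertible, and \<open>v\<close> is the multiple of \<open>(A - \<theta>\<^sub>i) (\<psi> v)\<close> by its inverse.\<close>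
    let ?c = "t k - t (Suc i)"
    have c: "?c \<noteq> 0"
      using t_distinct[of k "Suc i"] 4 by simp
    have psi: "\<psi> v \<in> MK d A E Es k"
      using Suc.IH[of "\<psi> v"] Suc.prems i psi_U[OF i] L_commutes_psi[OF i] by (simp add: psi.scale)
    have "scale ?c v = A (\<psi> v) - scale (\<theta> i) (\<psi> v)"
      using L_raise_psi[OF i Suc.prems(2)] Suc.prems(3) by (simp add: scale_left_diff_distrib)
    also have "\<dots> \<in> MK d A E Es k"
      by (intro subspace_diff subspace_scale subspace_MK A_MK psi)
    finally have "scale (inverse ?c) (scale ?c v) \<in> MK d A E Es k"
      by (rule subspace_scale[OF subspace_MK])
    then show ?thesis
      using c by simp
  qed
qed

theorem MK_eq_eigenspace:
  assumes k: "2 * k \<le> d"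
  shows "MK d A E Es k = {v. L v = scale (t k) v}" (is "_ = ?Z")
proof
  have Z: "subspace ?Z"
    by (rule subspace_eq_scale[OF endo_L])
  show "MK d A E Es k \<subseteq> ?Z"
    by (rule MK_minimal[OF Z]) (auto simp: L_split_K k L_commutes_A A.scale)
  have KZ: "K ` ?Z \<subseteq> ?Z"
    by (auto simp: L_commutes_K K.scale)
  show "?Z \<subseteq> MK d A E Es k"
  proof
    fix v assume "v \<in> ?Z"
    then obtain u where u: "\<And>i. i \<le> d \<Longrightarrow> u i \<in> U i \<inter> ?Z" "v = (\<Sum>i\<le>d. u i)"
      using graded_components[OF Z KZ] by blast
    then show "v \<in> MK d A E Es k"
      using eigenvector_in_MK[OF k] by (auto intro!: subspace_sum subspace_MK)
  qed
qed

end

section \<open>Relations satisfied by the module action\<close>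

context lin_space
begin

lemma Uq_module_action:
  assumes "Uq_module q \<rho>"
  shows "\<rho> (uq_class q (x * y)) v = \<rho> (uq_class q x) (\<rho> (uq_class q y) v)"
    and "\<rho> (uq_class q (x + y)) v = \<rho> (uq_class q x) v + \<rho> (uq_class q y) v"
    and "\<rho> (uq_class q (uq_scalar c)) v = scale c v"
    and "endo (\<rho> (uq_class q x))"
proof -
  have \<rho>: "\<rho> \<in> ring_hom (Uq_sl2 q) End_ring" "\<rho> (uq_class q (uq_scalar c)) = scale c" for c
    using assms by (auto simp: Uq_module_def)
  have C: "uq_class q x \<in> carrier (Uq_sl2 q)"
    "uq_class q (x * y) = uq_class q x \<otimes>\<^bsub>Uq_sl2 q\<^esub> uq_class q y"
    "uq_class q (x + y) = uq_class q x \<oplus>\<^bsub>Uq_sl2 q\<^esub> uq_class q y" for x y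
    using uq_class_hom[of q] by (auto simp: ring_hom_def uq_free_ring_def)
  show "\<rho> (uq_class q (x * y)) v = \<rho> (uq_class q x) (\<rho> (uq_class q y) v)"
    "\<rho> (uq_class q (x + y)) v = \<rho> (uq_class q x) v + \<rho> (uq_class q y) v"
    "\<rho> (uq_class q (uq_scalar c)) v = scale c v"
    unfolding C(2,3) ring_hom_mult[OF \<rho>(1) C(1) C(1)] ring_hom_add[OF \<rho>(1) C(1) C(1)] \<rho>(2)
    by (simp_all add: End_ring_def)
  show "endo (\<rho> (uq_class q x))"
    using ring_hom_closed[OF \<rho>(1) C(1)] by (simp add: End_ring_def)
qed

lemma Uq_module_relations:
  assumes \<rho>: "Uq_module q \<rho>"
  defines "k \<equiv> \<rho> (uq_class q (uq_gen Gen_k))" and "k' \<equiv> \<rho> (uq_class q (uq_gen Gen_kinv))"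
    and "e \<equiv> \<rho> (uq_class q (uq_gen Gen_e))"
  shows "k (k' v) = v" "k' (k v) = v" "k (e (k' v)) = scale (q\<^sup>2) (e v)"
proof -
  have rel: "uq_class q x = uq_class q y" if "x - y \<in> uq_relators q" for x y
    using that uq_relators_subset[of q] uq_class_eq[of q x y] by blast
  have one: "\<rho> (uq_class q 1) v = v"
    using Uq_module_action(3)[OF \<rho>, of 1 v] by (simp add: uq_scalar_def)
  have "uq_class q (uq_gen Gen_k * uq_gen Gen_kinv) = uq_class q 1"
    "uq_class q (uq_gen Gen_kinv * uq_gen Gen_k) = uq_class q 1"
    "uq_class q (uq_gen Gen_k * uq_gen Gen_e * uq_gen Gen_kinv)
      = uq_class q (uq_scalar (q\<^sup>2) * uq_gen Gen_e)"
    by (rule rel, simp add: uq_relators_def Let_def)+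
  from this[THEN arg_cong[of _ _ "\<lambda>C. \<rho> C v"]]
  show "k (k' v) = v" "k' (k v) = v" "k (e (k' v)) = scale (q\<^sup>2) (e v)"
    unfolding k_def k'_def e_def by (simp_all add: one Uq_module_action(1-3)[OF \<rho>])
qed

lemma casimir_action:
  assumes \<rho>: "Uq_module q \<rho>"
  shows "\<rho> (casimir q) v =
    scale ((q - inverse q)\<^sup>2) (\<rho> (uq_class q (uq_gen Gen_e)) (\<rho> (uq_class q (uq_gen Gen_f)) v))
      + scale (inverse q) (\<rho> (uq_class q (uq_gen Gen_k)) v)
      + scale q (\<rho> (uq_class q (uq_gen Gen_kinv)) v)"
  unfolding casimir_def by (simp add: Uq_module_action(1-3)[OF \<rho>] mult.assoc)

end

lemma add_inverse_eq_iff: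
  fixes x y :: "'a::field"
  assumes "x \<noteq> 0" "y \<noteq> 0"
  shows "x + inverse x = y + inverse y \<longleftrightarrow> x = y \<or> x * y = 1"
proof -
  have "x + inverse x - (y + inverse y) = (x - y) * (x * y - 1) / (x * y)"
    using assms by (simp add: field_simps)
  then show ?thesis
    using assms by (metis divide_eq_0_iff eq_iff_diff_eq_0 mult_eq_0_iff)
qed

text \<open>
  The two summands of \<open>t\<^sub>i\<close> are inverse to each other, so \<open>t\<^sub>h = t\<^sub>k\<close> would force
  \<open>q\<^bsup>2(k-h)\<^esup> = 1\<close> or \<open>q\<^bsup>2(d+1-h-k)\<^esup> = 1\<close>. Both exponents are in the range covered by the
  hypothesis: \<open>h < k\<close> gives \<open>h + k \<ge> 1\<close>, so \<open>d + 1 - h - k \<le> d\<close>.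
\<close>
lemma casimir_eigenvalue_distinct:
  fixes q :: "'a::field"
  assumes q: "q \<noteq> 0" and nonroot: "\<And>n. 1 \<le> n \<Longrightarrow> n \<le> d \<Longrightarrow> q powi (2 * int n) \<noteq> 1"
    and hk: "h < k" "h + k \<le> d"
  shows "q powi (int d - 2 * int h + 1) + q powi (2 * int h - int d - 1)
    \<noteq> q powi (int d - 2 * int k + 1) + q powi (2 * int k - int d - 1)"
proof
  define x where "x i = q powi (int d - 2 * int i + 1)" for i
  have inv: "q powi (2 * int i - int d - 1) = inverse (x i)" for i
    unfolding x_def power_int_minus[symmetric] by (rule arg_cong[of _ _ "power_int q"]) simp
  have x0: "x i \<noteq> 0" for i
    using q by (simp add: x_def)
  assume "q powi (int d - 2 * int h + 1) + q powi (2 * int h - int d - 1)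
    = q powi (int d - 2 * int k + 1) + q powi (2 * int k - int d - 1)"
  then have "x h = x k \<or> x h * x k = 1"
    unfolding inv using add_inverse_eq_iff[OF x0 x0] by (simp add: x_def)
  moreover have "x h = q powi (2 * int (k - h)) * x k"
  proof -
    have "int d - 2 * int h + 1 = 2 * int (k - h) + (int d - 2 * int k + 1)"
      using hk by simp
    then show ?thesis
      unfolding x_def by (simp only: power_int_add[OF disjI1[OF q]])
  qed
  moreover have "x h * x k = q powi (2 * int (d + 1 - h - k))"
  proof -
    have "2 * int (d + 1 - h - k) = (int d - 2 * int h + 1) + (int d - 2 * int k + 1)"
      using hk by simp
    then show ?thesis
      unfolding x_def by (simp only: power_int_add[OF disjI1[OF q]])
  qed
  ultimately show False
    using nonroot[of "k - h"] nonroot[of "d + 1 - h - k"] x0[of k] hk by auto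
qed

section \<open>The eigenspaces of the normalized Casimir element\<close>

theorem lemma7p10:
  fixes scale :: "'k::alg_closed_field \<Rightarrow> 'v::ab_group_add \<Rightarrow> 'v"
    and Basis :: "'v set"
    and A As K R \<psi> :: "'v \<Rightarrow> 'v"
    and E Es :: "nat \<Rightarrow> 'v \<Rightarrow> 'v"
    and d :: nat
    and q a b :: 'k
    and \<rho> :: "'k uq_free set \<Rightarrow> 'v \<Rightarrow> 'v"
  assumes V_fin_dim: "finite_dimensional_vector_space scale Basis"
    and V_nonzero: "\<exists>v::'v. v \<noteq> 0"
    and TD: "lin_space.TD_system scale d A E As Es"
    and d: "d \<ge> 1"
    and Racah: "lin_space.q_Racah scale d A E As Es q a b"
    and K_linear: "Vector_Spaces.linear scale scale K"
    and K_on_U: "\<forall>i\<le>d. \<forall>u\<in>lin_space.split_U scale d E Es i.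
                   K u = scale (q powi (int d - 2 * int i)) u"
    and R_def: "R = (\<lambda>v. A v - scale a (K v) - scale (inverse a) (inv_into UNIV K v))"
    and psi_linear: "Vector_Spaces.linear scale scale \<psi>"
    and psi_R: "\<forall>v. \<psi> (R v) - R (\<psi> v) = scale (q - inverse q) (K v - inv_into UNIV K v)"
    and psi_K: "\<forall>i. 2 * i \<le> d \<longrightarrow> (\<forall>v\<in>lin_space.split_K scale d E Es i. \<psi> v = 0)"
    and V_module: "lin_space.Uq_module scale q \<rho>"
    and act_e: "\<rho> (uq_class q (uq_gen Gen_e)) = (\<lambda>v. scale (inverse (q - inverse q)) (\<psi> v))"
    and act_f: "\<rho> (uq_class q (uq_gen Gen_f)) = (\<lambda>v. scale (inverse (q - inverse q)) (R v))"
    and act_k: "\<rho> (uq_class q (uq_gen Gen_k)) = K"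
    and act_kinv: "\<rho> (uq_class q (uq_gen Gen_kinv)) = inv_into UNIV K"
  shows "\<forall>i. 2 * i \<le> d \<longrightarrow>
           (let \<theta> = q powi (int d - 2 * int i + 1) + q powi (2 * int i - int d - 1);
                W = lin_space.MK scale d A E Es i
            in W = {v. \<rho> (casimir q) v = scale \<theta> v} \<and>
               (W \<noteq> {0} \<longrightarrow>
                  lin_space.eigenspace_with_eigenvalue scale (\<rho> (casimir q)) W \<theta>))"
proof -
  interpret V: lin_space scale
    using V_fin_dim unfolding lin_space_def finite_dimensional_vector_space_def by blast
  define \<theta> where "\<theta> i = a * q powi (int d - 2 * int i) + inverse a * q powi (2 * int i - int d)" for i
  define \<theta>s where "\<theta>s i = b * q powi (int d - 2 * int i) + inverse b * q powi (2 * int i - int d)" for i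
  define \<kappa> where "\<kappa> i = q powi (int d - 2 * int i)" for i
  define t where "t i = q powi (int d - 2 * int i + 1) + q powi (2 * int i - int d - 1)" for i
  define K' where "K' = inv_into UNIV K"
  have q: "q \<noteq> 0" "q ^ 4 \<noteq> 1"
    using Racah by (auto simp: V.q_Racah_def)
  interpret td_eigen scale d A As E Es \<theta> \<theta>s
    using TD Racah by unfold_locales (auto simp: V.q_Racah_def \<theta>_def \<theta>s_def)
  have kappa0: "\<kappa> i \<noteq> 0" for i
    using q by (simp add: \<kappa>_def)
  have kappa_inv: "q powi (2 * int i - int d) = inverse (\<kappa> i)" for i
    unfolding \<kappa>_def power_int_minus[symmetric] by (rule arg_cong[of _ _ "power_int q"]) simp
  have theta: "\<theta> i = a * \<kappa> i + inverse a * inverse (\<kappa> i)" for i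
    unfolding \<theta>_def kappa_inv by (simp add: \<kappa>_def)
  \<comment> \<open>\<open>\<theta>\<^sub>i\<close> is a function of \<open>\<kappa>\<^sub>i\<close>, so the \<open>\<kappa>\<^sub>i\<close> inherit distinctness from the \<open>\<theta>\<^sub>i\<close>.\<close>
  have inj_kappa: "inj_on \<kappa> {..d}"
    using inj_eigenvalue by (auto simp: inj_on_def theta)
  have nonroot: "q powi (2 * int n) \<noteq> 1" if n: "1 \<le> n" "n \<le> d" for n
  proof
    assume "q powi (2 * int n) = 1"
    moreover have "\<kappa> 0 = q powi (2 * int n) * \<kappa> n"
      unfolding \<kappa>_def using q by (subst power_int_add[symmetric]) auto
    ultimately have "\<kappa> 0 = \<kappa> n" by simp
    then show False
      using inj_onD[OF inj_kappa, of 0 n] n by simp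
  qed
  interpret td_grading scale d A As E Es \<theta> \<theta>s K \<kappa>
    using K_linear K_on_U inj_kappa
    by (intro td_grading.intro td_eigen_axioms td_grading_axioms.intro) (auto simp: \<kappa>_def)
  interpret psi: Vector_Spaces.linear scale scale \<psi> by (rule psi_linear)
  define c where "c = q - inverse q"
  have c: "c \<noteq> 0"
  proof
    assume "c = 0"
    then have "q * q = 1"
      using q(1) by (simp add: c_def field_simps)
    moreover have "q ^ 4 = (q * q) * (q * q)"
      by (simp add: power4_eq_xxxx mult.assoc)
    ultimately show False
      using q(2) by simp
  qed
  note rel = V.Uq_module_relations[OF V_module, unfolded act_k act_kinv act_e,
      folded K'_def c_def]
  note R = R_def[folded K'_def]
  have K'_U: "K' v = scale (inverse (\<kappa> i)) v" if "i \<le> d" "v \<in> U i" for i v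
  proof -
    have "K (scale (inverse (\<kappa> i)) v) = v"
      using K_U[OF that] kappa0 by (simp add: K.scale)
    then show ?thesis
      using rel(2) by metis
  qed
  have R_U: "R v = A v - scale (\<theta> i) v" if "i \<le> d" "v \<in> U i" for i v
    using K_U[OF that] K'_U[OF that] by (simp add: R theta V.scale_left_distrib)
  have L: "\<rho> (casimir q) v = \<psi> (R v) + scale (inverse q) (K v) + scale q (K' v)" for v
  proof -
    have "\<rho> (casimir q) v = scale (c\<^sup>2 * (inverse c * inverse c)) (\<psi> (R v))
        + scale (inverse q) (K v) + scale q (K' v)"
      unfolding V.casimir_action[OF V_module] act_k act_kinv act_e act_f K'_def c_def
      by (simp add: psi.scale)
    moreover have "c\<^sup>2 * (inverse c * inverse c) = 1"
      using c by (simp add: power2_eq_square field_simps)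
    ultimately show ?thesis by simp
  qed
  have L': "\<rho> (casimir q) v = R (\<psi> v) + scale q (K v) + scale (inverse q) (K' v)" for v
  proof -
    have "\<psi> (R v) = R (\<psi> v) + scale (q - inverse q) (K v - K' v)"
      using psi_R by (metis K'_def add_diff_cancel_left' add_diff_eq diff_add_cancel add.commute)
    then show ?thesis
      unfolding L by (simp add: V.scale_left_diff_distrib V.scale_right_diff_distrib algebra_simps)
  qed
  have t: "t i = q * \<kappa> i + inverse q * inverse (\<kappa> i)" for i
  proof -
    have "q powi (int d - 2 * int i + 1) = \<kappa> i * q"
      unfolding \<kappa>_def by (simp only: power_int_add[OF disjI1[OF q(1)]] power_int_1_right)
    moreover have "q powi (2 * int i - int d - 1) = inverse (\<kappa> i) / q"
      unfolding kappa_inv[symmetric] by (simp only: power_int_diff[OF disjI1[OF q(1)]] power_int_1_right)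
    ultimately show ?thesis
      by (simp add: t_def divide_inverse mult.commute)
  qed
  have kappa_Suc: "\<kappa> i = q\<^sup>2 * \<kappa> (Suc i)" for i
  proof -
    have "\<kappa> i = q powi (2 + (int d - 2 * int (Suc i)))"
      by (simp add: \<kappa>_def)
    also have "\<dots> = q\<^sup>2 * \<kappa> (Suc i)"
      unfolding \<kappa>_def using q(1) by (subst power_int_add) auto
    finally show ?thesis .
  qed
  have t_Suc: "t (Suc i) = inverse q * \<kappa> i + q * inverse (\<kappa> i)" for i
    using q(1) kappa0[of "Suc i"] unfolding t kappa_Suc[of i] by (simp add: field_simps power2_eq_square)
  interpret td_casimir scale d A As E Es \<theta> \<theta>s K \<kappa> \<psi> "\<rho> (casimir q)" t
  proof (intro td_casimir.intro td_grading_axioms td_casimir_axioms.intro)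
    show "V.endo (\<rho> (casimir q))"
      unfolding casimir_def by (rule V.Uq_module_action(4)[OF V_module])
    \<comment> \<open>The relation for \<open>k e k\<^bsup>-1\<^esup>\<close> makes \<open>\<psi> v\<close> a \<open>K\<close>-eigenvector for \<open>q\<^sup>2 \<kappa>\<^sub>i\<^sub>+\<^sub>1 = \<kappa>\<^sub>i\<close>.\<close>
    show psi_U: "\<psi> v \<in> U i" if i: "i < d" and v: "v \<in> U (Suc i)" for i v
    proof (rule K_eigenvector_in_U)
      have "K (\<psi> (K' v)) = scale (q\<^sup>2) (\<psi> v)"
      proof -
        have "scale (inverse c) (K (\<psi> (K' v))) = scale (inverse c) (scale (q\<^sup>2) (\<psi> v))"
          using rel(3)[of v] by (simp add: K.scale mult.commute)
        then show ?thesis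
          using c by (metis V.scale_left_imp_eq inverse_nonzero_iff_nonzero)
      qed
      then have "scale (inverse (\<kappa> (Suc i))) (K (\<psi> v)) = scale (q\<^sup>2) (\<psi> v)"
        using K'_U[OF _ v] i by (simp add: psi.scale K.scale)
      then have "scale (\<kappa> (Suc i)) (scale (inverse (\<kappa> (Suc i))) (K (\<psi> v)))
          = scale (\<kappa> (Suc i)) (scale (q\<^sup>2) (\<psi> v))"
        by simp
      then show "K (\<psi> v) = scale (\<kappa> i) (\<psi> v)"
        using kappa0[of "Suc i"] by (simp add: kappa_Suc[of i] mult.commute)
    qed (use i in simp)
    show "\<rho> (casimir q) v = \<psi> (A v - scale (\<theta> i) v) + scale (t (Suc i)) v"
      if "i \<le> d" "v \<in> U i" for i v
      unfolding L R_U[OF that] K_U[OF that] K'_U[OF that] t_Suc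
      by (simp add: V.scale_left_distrib)
    \<comment> \<open>This form covers \<open>i = 0\<close> as well, which the case of \<open>K\<^sub>0\<close> below needs.\<close>
    have L_U: "\<rho> (casimir q) v = R (\<psi> v) + scale (t i) v" if "i \<le> d" "v \<in> U i" for i v
      unfolding L' K_U[OF that] K'_U[OF that] t by (simp add: V.scale_left_distrib)
    show "\<rho> (casimir q) v = A (\<psi> v) - scale (\<theta> i) (\<psi> v) + scale (t (Suc i)) v"
      if "i < d" "v \<in> U (Suc i)" for i v
      using L_U[of "Suc i" v] R_U[of i "\<psi> v"] psi_U[OF that] that by simp
    show "\<rho> (casimir q) v = scale (t i) v" if i: "2 * i \<le> d" and v: "v \<in> V.split_K d E Es i" for i v
    proof -
      have "R 0 = 0"
        using R_U[of 0 0] V.subspace_0[OF subspace_U] by simp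
      then show ?thesis
        using L_U[of i v] psi_K i v split_K_subset_U[of i] by auto
    qed
    show "t (Suc d - i) = t i" if "i \<le> Suc d" for i
    proof -
      have "int d - 2 * int (Suc d - i) + 1 = 2 * int i - int d - 1"
        "2 * int (Suc d - i) - int d - 1 = int d - 2 * int i + 1"
        using that by auto
      then show ?thesis
        unfolding t_def by (simp only: add.commute)
    qed
    show "t h \<noteq> t k" if "h < k" "h + k \<le> d" for h k
      unfolding t_def by (rule casimir_eigenvalue_distinct[OF q(1) nonroot that])
  qed (rule psi_linear)
  show ?thesis
    unfolding Let_def V.eigenspace_with_eigenvalue_def t_def[symmetric]
    using MK_eq_eigenspace subspace_MK by blast
qed

end
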